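(* Let $(\phi_t)_{t\ge0}$ be a continuous one-parameter semigroup of holomorphic functions in the unit disk $\mathbb{D}$. Then every regular backward orbit of $(\phi_t)$ is Lipschitz.
   Context: A (continuous one-parameter) semigroup in $\mathbb{D}$ is a family $(\phi_t)_{t\ge0}$ of holomorphic functions $\phi_t:\mathbb{D}\to\mathbb{D}$ such that $\phi_0=\mathrm{id}_{\mathbb{D}}$, $\phi_{t+s}=\phi_t\circ\phi_s$ for all $t,s\ge0$, and $\phi_t\to\phi_0$ locally uniformly as $t\to0^+$; every $\phi_t$ is univalent. For $z\in\mathbb{D}$, $T_z\in(0,+\infty]$ is the supremum of all $T>0$ such that $z\in\phi_t(\mathbb{D})$ for every $t\in[0,T)$, and the backward orbit of $z$ is $\tilde\gamma_z:[0,T_z)\to\mathbb{D}$, $\tilde\gamma_z(t)=\phi_t^{-1}(z)$. The backward orbit is regular if $T_z=+\infty$ and $\limsup_{t\to+\infty}k_{\mathbb{D}}(\tilde\gamma_z(t),\tilde\gamma_z(t+1))<+\infty$, where $k_{\mathbb{D}}(z,w)=\frac12\log\frac{|1-\bar z w|+|z-w|}{|1-\bar z w|-|z-w|}$ is the hyperbolic distance of $\mathbb{D}$. A function $\gamma:I\to\mathbb{C}$ on an interval $I\subset\mathbb{R}$ is Lipschitz if there is $C>0$ with $|\gamma(t)-\gamma(s)|\le C|t-s|$ for all $t,s\in I$. *)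

theory Defs
  imports "HOL-Complex_Analysis.Complex_Analysis"
begin

abbreviation unit_disc :: "complex set" where
  "unit_disc \<equiv> ball 0 1"

(* Local uniform convergence in the open disc is rendered as uniform convergence on
   compact subsets. Only the values phi t z with t >= 0 and z in the disc are
   constrained. Univalence of the maps phi t is a consequence, not a requirement. *)
definition holomorphic_semigroup :: "(real \<Rightarrow> complex \<Rightarrow> complex) \<Rightarrow> bool" where
  "holomorphic_semigroup \<phi> \<longleftrightarrow>
     (\<forall>t\<ge>0. \<phi> t holomorphic_on unit_disc \<and> \<phi> t ` unit_disc \<subseteq> unit_disc) \<and>
     (\<forall>z\<in>unit_disc. \<phi> 0 z = z) \<and>
     (\<forall>t\<ge>0. \<forall>s\<ge>0. \<forall>z\<in>unit_disc. \<phi> (t + s) z = \<phi> t (\<phi> s z)) \<and>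
     (\<forall>K. compact K \<and> K \<subseteq> unit_disc \<longrightarrow> uniform_limit K \<phi> (\<phi> 0) (at_right 0))"

definition hyperbolic_dist :: "complex \<Rightarrow> complex \<Rightarrow> real" where
  "hyperbolic_dist z w =
     1 / 2 * ln ((cmod (1 - cnj z * w) + cmod (z - w)) / (cmod (1 - cnj z * w) - cmod (z - w)))"

definition backward_lifetime :: "(real \<Rightarrow> complex \<Rightarrow> complex) \<Rightarrow> complex \<Rightarrow> ereal" where
  "backward_lifetime \<phi> z = Sup {ereal T | T. 0 < T \<and> (\<forall>t\<in>{0..<T}. z \<in> \<phi> t ` unit_disc)}"

definition backward_domain :: "(real \<Rightarrow> complex \<Rightarrow> complex) \<Rightarrow> complex \<Rightarrow> real set" where
  "backward_domain \<phi> z = {t. 0 \<le> t \<and> ereal t < backward_lifetime \<phi> z}"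

(* Meaningful only for t in backward_domain phi z, where z has a preimage under phi t;
   the preimage is unique because phi t is univalent. *)
definition backward_orbit :: "(real \<Rightarrow> complex \<Rightarrow> complex) \<Rightarrow> complex \<Rightarrow> real \<Rightarrow> complex" where
  "backward_orbit \<phi> z t = inv_into unit_disc (\<phi> t) z"

definition regular_backward_orbit :: "(real \<Rightarrow> complex \<Rightarrow> complex) \<Rightarrow> complex \<Rightarrow> bool" where
  "regular_backward_orbit \<phi> z \<longleftrightarrow>
     backward_lifetime \<phi> z = \<infinity> \<and>
     Limsup at_top (\<lambda>t. ereal (hyperbolic_dist (backward_orbit \<phi> z t) (backward_orbit \<phi> z (t + 1)))) < \<infinity>"

end

(* Let G be the infinitesimal generator, so that orbits satisfy d/dt phi_t(z) = G(phi_t(z)). A backward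
   orbit gamma is an orbit run backwards, hence Lipschitz once G is bounded along gamma. Move
   p = gamma(t) to 0 by an automorphism of the disc, which turns G into a generator W with
   W(0) = G(p)/(1 - |p|^2). The infinitesimal Schwarz-Pick inequality gives
   W(z) = W(0) - conj(W(0)) z^2 - z q(z) with Re q >= 0, so if W has no zeros near 0, Harnack's
   inequality yields |W| >= c |W(0)| on hyperbolic discs of fixed radius. Let h solve h' G = lambda h with
   exp(lambda) <> 1 (the Koenigs function). Then h(phi_1(p)) = exp(lambda) h(p), whereas phi_1(p) lies
   within bounded distance of p and the logarithmic derivative lambda/W of h is there
   at most |lambda| / (c |W(0)|): a large W(0) is impossible. A zero of G is a common
   fixed point, and either gamma stays at bounded distance from it, so that G is bounded along gamma by
   compactness, or gamma eventually stays far away from it and the argument applies. *)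

theory Submission
  imports Defs
begin

subsection \<open>The Schwarz-Pick inequality\<close>

text \<open>Two facts about the semigroup have to be established before G can be used. The flow is
  assumed only continuous in time, so G must be constructed: the integral of the flow over a short
  time interval is locally invertible in z and differentiable along orbits, and differentiability
  then passes to the orbits themselves. Univalence, needed for gamma(t + s) to flow to gamma(t),
  comes from uniqueness for the differential equation. The lower bound on |W| must be uniform over
  all p, so its constant may depend on radii only; a minimum principle, valid because W has no
  zeros, bounds q(0) by W(0). The condition exp(lambda) <> 1 is there because the change of log h
  from p to phi_1(p) is known only modulo 2 pi i: it keeps every possible value of that change away
  from 0. For rotations about a fixed point exp(lambda) = 1 can happen; that case avoids h, since
  the orbit stays on a hyperbolic circle.\<close>

abbreviation disc_shift :: "complex \<Rightarrow> complex \<Rightarrow> complex" where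
  "disc_shift p \<equiv> Moebius_function 0 p"

lemma one_minus_cnj_mult_nonzero:
  assumes "norm w < 1" "norm z < 1"
  shows "1 - cnj w * z \<noteq> 0"
proof -
  have "norm (cnj w * z) < 1"
    using norm_mult_less[of "cnj w" 1 z 1] assms by simp
  then show ?thesis by force
qed

lemma disc_shift_in_disc:
  "p \<in> unit_disc \<Longrightarrow> z \<in> unit_disc \<Longrightarrow> disc_shift p z \<in> unit_disc"
  by (simp add: Moebius_function_norm_lt_1)

lemma disc_shift_inverse:
  assumes "p \<in> unit_disc" "z \<in> unit_disc"
  shows "disc_shift p (disc_shift (-p) z) = z" "disc_shift (-p) (disc_shift p z) = z"
  using Moebius_function_compose[of p "-p" z] Moebius_function_compose[of "-p" p z] assms by auto

text \<open>This norm is the pseudohyperbolic distance of p and z, the tanh of their hyperbolic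
  distance. Hyperbolic distances are measured by it below.\<close>

lemma norm_disc_shift_commute: "norm (disc_shift p z) = norm (disc_shift z p)"
proof -
  have "norm (1 - cnj p * z) = norm (cnj (1 - cnj p * z))" by (rule complex_mod_cnj[symmetric])
  also have "\<dots> = norm (1 - cnj z * p)" by (simp add: mult.commute)
  finally show ?thesis
    by (simp add: Moebius_function_simple norm_divide norm_minus_commute)
qed

lemma has_field_derivative_disc_shift:
  assumes "p \<in> unit_disc" "z \<in> unit_disc"
  shows "(disc_shift p has_field_derivative (1 - (norm p)\<^sup>2) / (1 - cnj p * z)\<^sup>2) (at z)"
proof -
  have nz: "1 - cnj p * z \<noteq> 0"
    using one_minus_cnj_mult_nonzero assms by simp
  have "cnj p * p = of_real ((norm p)\<^sup>2)"
    by (metis complex_norm_square mult.commute)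
  with nz show ?thesis
    unfolding Moebius_function_simple
    by (auto intro!: derivative_eq_intros simp: power2_eq_square field_simps)
qed

text \<open>Conjugation by disc automorphisms moves both z and \<open>f z\<close> to 0, where the
  Schwarz lemma applies.\<close>

lemma Schwarz_Pick:
  assumes holf: "f holomorphic_on unit_disc" and im: "f ` unit_disc \<subseteq> unit_disc"
    and z: "z \<in> unit_disc" and w: "w \<in> unit_disc"
  shows "norm (disc_shift (f z) (f w)) \<le> norm (disc_shift z w)"
proof -
  define g where "g = disc_shift (f z) \<circ> f \<circ> disc_shift (-z)"
  have fz: "f z \<in> unit_disc" using im z by blast
  have "disc_shift (-z) ` unit_disc \<subseteq> unit_disc"
    using z Moebius_function_norm_lt_1[of "-z"] by (auto simp: dist_norm)
  moreover have "disc_shift (-z) holomorphic_on unit_disc" "disc_shift (f z) holomorphic_on unit_disc"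
    using z fz by (auto intro!: Moebius_function_holomorphic)
  ultimately have "g holomorphic_on unit_disc"
    unfolding g_def using holf im
    by (intro holomorphic_on_compose_gen[where t = unit_disc]) (auto intro!: holomorphic_on_compose_gen)
  moreover have "g 0 = 0"
    by (simp add: g_def Moebius_function_of_zero Moebius_function_eq_zero)
  moreover have "norm (g x) < 1" if "norm x < 1" for x
  proof -
    have "disc_shift (-z) x \<in> unit_disc"
      using that z Moebius_function_norm_lt_1[of "-z"] by auto
    then have "f (disc_shift (-z) x) \<in> unit_disc" using im by blast
    then show ?thesis
      using fz Moebius_function_norm_lt_1 by (auto simp: g_def)
  qed
  moreover have "norm (disc_shift z w) < 1"
    using z w Moebius_function_norm_lt_1 by auto
  ultimately have "norm (g (disc_shift z w)) \<le> norm (disc_shift z w)"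
    by (rule Schwarz_Lemma)
  then show ?thesis
    using disc_shift_inverse(2)[OF z w] by (simp add: g_def)
qed

text \<open>The Schwarz-Pick inequality for \<open>f t\<close> and the points 0 and z is an equality
  at t = 0, so differentiating it there from the right gives an inequality between
  derivatives.\<close>

lemma infinitesimal_Schwarz_Pick:
  assumes f: "\<And>t. 0 \<le> t \<Longrightarrow> f t holomorphic_on unit_disc \<and> f t ` unit_disc \<subseteq> unit_disc"
    and f0: "\<And>z. z \<in> unit_disc \<Longrightarrow> f 0 z = z"
    and v: "\<And>z. z \<in> unit_disc \<Longrightarrow> ((\<lambda>t. f t z) has_vector_derivative v z) (at 0 within {0..})"
    and z: "z \<in> unit_disc"
  shows "Re (cnj z * (v z - v 0 + cnj (v 0) * z\<^sup>2)) \<le> 0"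
proof -
  define d where "d t = f t z - f t 0" for t
  define e where "e t = 1 - cnj (f t 0) * f t z" for t
  \<comment> \<open>The difference of the squared sides of Schwarz-Pick with the denominator
    cleared; products with conjugates are used because they can be differentiated by the product
    rule.\<close>
  define u where "u t = Re (d t * cnj (d t)) - (norm z)\<^sup>2 * Re (e t * cnj (e t))" for t
  have sq: "Re (x * cnj x) = (norm x)\<^sup>2" for x
    by (simp add: complex_mult_cnj cmod_power2)
  have v0: "((\<lambda>t. f t 0) has_vector_derivative v 0) (at 0 within {0..})"
    and vz: "((\<lambda>t. f t z) has_vector_derivative v z) (at 0 within {0..})"
    using v z by auto
  have vd: "(d has_vector_derivative (v z - v 0)) (at 0 within {0..})"
    unfolding d_def by (intro derivative_intros v0 vz)
  have "((\<lambda>t. cnj (f t 0)) has_vector_derivative cnj (v 0)) (at 0 within {0..})"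
    by (rule has_vector_derivative_cnj[OF v0])
  then have ve: "(e has_vector_derivative (- (cnj (v 0) * z))) (at 0 within {0..})"
    unfolding e_def using v0 vz f0[of 0] f0[OF z]
    by (auto intro!: derivative_eq_intros)
  have d0: "d 0 = z" "e 0 = 1"
    using f0[of 0] f0[OF z] by (auto simp: d_def e_def)
  have "((\<lambda>t. Re (d t * cnj (d t))) has_real_derivative Re (z * cnj (v z - v 0) + (v z - v 0) * cnj z)) (at 0 within {0..})"
    using bounded_linear.has_vector_derivative[OF bounded_linear_Re
        has_vector_derivative_mult[OF vd has_vector_derivative_cnj[OF vd]]] d0
    by (simp add: has_real_derivative_iff_has_vector_derivative)
  moreover have "((\<lambda>t. Re (e t * cnj (e t))) has_real_derivative Re (cnj (- (cnj (v 0) * z)) + - (cnj (v 0) * z))) (at 0 within {0..})"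
    using bounded_linear.has_vector_derivative[OF bounded_linear_Re
        has_vector_derivative_mult[OF ve has_vector_derivative_cnj[OF ve]]] d0
    by (simp add: has_real_derivative_iff_has_vector_derivative)
  ultimately have "(u has_real_derivative
      (Re (z * cnj (v z - v 0) + (v z - v 0) * cnj z)
       - (norm z)\<^sup>2 * Re (cnj (- (cnj (v 0) * z)) + - (cnj (v 0) * z)))) (at 0 within {0..})"
    unfolding u_def by (intro DERIV_diff DERIV_cmult)
  moreover have "Re (z * cnj (v z - v 0) + (v z - v 0) * cnj z)
       - (norm z)\<^sup>2 * Re (cnj (- (cnj (v 0) * z)) + - (cnj (v 0) * z))
     = 2 * Re (cnj z * (v z - v 0 + cnj (v 0) * z\<^sup>2))"
    unfolding cmod_power2 by (simp add: power2_eq_square algebra_simps)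
  ultimately have du: "(u has_real_derivative 2 * Re (cnj z * (v z - v 0 + cnj (v 0) * z\<^sup>2))) (at 0 within {0..})"
    by simp
  have u0: "u 0 = 0"
    by (simp only: u_def d0 sq norm_one) simp
  have uneg: "u t \<le> 0" if "t \<ge> 0" for t
  proof -
    have im: "f t ` unit_disc \<subseteq> unit_disc" and hol: "f t holomorphic_on unit_disc"
      using f[OF that] by auto
    have "norm (disc_shift (f t 0) (f t z)) \<le> norm (disc_shift 0 z)"
      by (rule Schwarz_Pick[OF hol im]) (use z in auto)
    then have "norm (d t) / norm (e t) \<le> norm z"
      by (simp add: Moebius_function_simple norm_divide d_def e_def)
    moreover have "f t 0 \<in> unit_disc" "f t z \<in> unit_disc"
      using im z by (meson centre_in_ball image_subset_iff zero_less_one)+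
    then have "e t \<noteq> 0"
      using one_minus_cnj_mult_nonzero unfolding e_def by simp
    ultimately have "norm (d t) \<le> norm z * norm (e t)"
      by (simp add: field_simps)
    then have "(norm (d t))\<^sup>2 \<le> (norm z * norm (e t))\<^sup>2"
      by (intro power_mono) auto
    then show ?thesis
      unfolding u_def sq by (simp add: power_mult_distrib)
  qed
  have "((\<lambda>t. (u t - u 0) / (t - 0)) \<longlongrightarrow> 2 * Re (cnj z * (v z - v 0 + cnj (v 0) * z\<^sup>2))) (at 0 within {0..})"
    using du by (simp add: has_field_derivative_iff)
  then have "2 * Re (cnj z * (v z - v 0 + cnj (v 0) * z\<^sup>2)) \<le> 0"
  proof (rule tendsto_upperbound)
    show "\<forall>\<^sub>F t in at 0 within {0..}. (u t - u 0) / (t - 0) \<le> 0"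
      using uneg u0 by (auto simp: eventually_at_filter divide_le_0_iff intro!: always_eventually)
    show "at (0::real) within {0..} \<noteq> bot"
      by (simp add: at_within_Ici_at_right)
  qed
  then show ?thesis by simp
qed

subsection \<open>Harnack estimates for generators\<close>

text \<open>A Cayley transform takes the right half-plane to the disc and \<open>q 0\<close> to 0;
  the Schwarz lemma applies to its composition with q.\<close>

lemma Harnack_difference:
  fixes q :: "complex \<Rightarrow> complex"
  assumes holq: "q holomorphic_on unit_disc" and pos: "\<And>z. z \<in> unit_disc \<Longrightarrow> 0 < Re (q z)"
    and z: "z \<in> unit_disc"
  shows "norm (q z - q 0) \<le> norm z * norm (q z + cnj (q 0))"
proof -
  define f where "f w = (q w - q 0) / (q w + cnj (q 0))" for w
  have nz: "q w + cnj (q 0) \<noteq> 0" if "w \<in> unit_disc" for w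
  proof -
    have "Re (q w + cnj (q 0)) > 0" using pos[OF that] pos[of 0] by simp
    then show ?thesis by fastforce
  qed
  have "f holomorphic_on unit_disc"
    unfolding f_def using nz by (intro holomorphic_intros holq) auto
  moreover have "f 0 = 0" by (simp add: f_def)
  moreover have "norm (f w) < 1" if "norm w < 1" for w
  proof -
    have "(norm (q w + cnj (q 0)))\<^sup>2 - (norm (q w - q 0))\<^sup>2 = 4 * Re (q w) * Re (q 0)"
      unfolding cmod_power2 by (simp add: power2_eq_square algebra_simps)
    also have "\<dots> > 0" using pos[of w] pos[of 0] that by simp
    finally have "norm (q w - q 0) < norm (q w + cnj (q 0))"
      by (simp add: power_less_imp_less_base)
    then show ?thesis by (simp add: f_def norm_divide divide_less_eq)
  qed
  ultimately have "norm (f z) \<le> norm z"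
    using z by (intro Schwarz_Lemma) auto
  then show ?thesis
    using nz[OF z] by (simp add: f_def norm_divide divide_le_eq)
qed

text \<open>The strict case is applied to q + e, and e tends to 0. The bounds concern the modulus of
  q, not only its real part, and are kept free of division.\<close>

lemma Harnack_pos:
  fixes q :: "complex \<Rightarrow> complex"
  assumes holq: "q holomorphic_on unit_disc" and nonneg: "\<And>z. z \<in> unit_disc \<Longrightarrow> 0 \<le> Re (q z)"
    and z: "z \<in> unit_disc"
  shows "norm (q z) * (1 - norm z) \<le> norm (q 0) * (1 + norm z)"
    and "norm (q 0) * (1 - norm z) \<le> norm (q z) * (1 + norm z)"
proof -
  have *: "norm (q z + of_real e - (q 0 + of_real e)) \<le> norm z * norm (q z + of_real e + cnj (q 0 + of_real e))"
    if "e > 0" for e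
    using that nonneg z
    by (intro Harnack_difference[where q = "\<lambda>w. q w + of_real e"] holomorphic_intros holq)
      (auto simp: add_nonneg_pos)
  have "((\<lambda>e. norm z * norm (q z + of_real e + cnj (q 0 + of_real e))) \<longlongrightarrow>
      norm z * norm (q z + of_real 0 + cnj (q 0 + of_real 0))) (at_right 0)"
    by (intro tendsto_intros)
  then have "norm (q z - q 0) \<le> norm z * norm (q z + of_real 0 + cnj (q 0 + of_real 0))"
  proof (rule tendsto_lowerbound)
    show "\<forall>\<^sub>F e in at_right 0. norm (q z - q 0) \<le> norm z * norm (q z + of_real e + cnj (q 0 + of_real e))"
      using * by (auto simp: eventually_at_filter intro!: always_eventually)
  qed auto
  also have "\<dots> \<le> norm z * (norm (q z) + norm (q 0))"
    by (intro mult_left_mono) (auto intro: order.trans[OF norm_triangle_ineq])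
  finally have "norm (q z - q 0) \<le> norm z * (norm (q z) + norm (q 0))" .
  moreover have "norm (q z) - norm (q 0) \<le> norm (q z - q 0)" "norm (q 0) - norm (q z) \<le> norm (q z - q 0)"
    using norm_triangle_ineq2[of "q z" "q 0"] norm_triangle_ineq2[of "q 0" "q z"] by (auto simp: norm_minus_commute)
  ultimately show "norm (q z) * (1 - norm z) \<le> norm (q 0) * (1 + norm z)"
    "norm (q 0) * (1 - norm z) \<le> norm (q z) * (1 + norm z)"
    by (auto simp: algebra_simps)
qed

text \<open>The function W(0) - W(z) - conj(W(0)) z^2 vanishes at 0, which allows the division by z.
  The hypothesis then reads |z|^2 Re q(z) >= 0, and continuity settles z = 0. For W(0) = 0 this is
  the Berkson-Porta formula with fixed point 0.\<close>

lemma generator_decomposition: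
  assumes hol: "W holomorphic_on unit_disc"
    and isp: "\<And>z. z \<in> unit_disc \<Longrightarrow> Re (cnj z * (W z - W 0 + cnj (W 0) * z\<^sup>2)) \<le> 0"
  obtains q where "q holomorphic_on unit_disc" "\<And>z. z \<in> unit_disc \<Longrightarrow> 0 \<le> Re (q z)"
    "\<And>z. z \<in> unit_disc \<Longrightarrow> W z = W 0 - cnj (W 0) * z\<^sup>2 - z * q z"
proof -
  have "(\<lambda>z. W 0 - W z - cnj (W 0) * z\<^sup>2) holomorphic_on ball 0 1"
    by (intro holomorphic_intros hol)
  then obtain q where q: "q holomorphic_on ball 0 1"
    "\<And>z. norm z < 1 \<Longrightarrow> W 0 - W z - cnj (W 0) * z\<^sup>2 = z * q z"
    by (rule Schwarz3) auto
  have nn: "0 \<le> Re (q z)" if "z \<in> unit_disc" "z \<noteq> 0" for z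
  proof -
    have "Re (cnj z * (W z - W 0 + cnj (W 0) * z\<^sup>2)) = - Re (cnj z * (z * q z))"
      using q(2)[of z] that(1) by (simp add: algebra_simps flip: q(2)[of z])
    also have "cnj z * (z * q z) = of_real ((norm z)\<^sup>2) * q z"
      by (metis complex_norm_square mult.assoc mult.commute)
    finally have "0 \<le> (norm z)\<^sup>2 * Re (q z)"
      using isp[OF that(1)] by simp
    then show ?thesis using that(2) by (simp add: zero_le_mult_iff)
  qed
  have "isCont q 0"
    using q(1) by (auto intro: continuous_on_interior holomorphic_on_imp_continuous_on simp: interior_open)
  then have "(\<lambda>z. Re (q z)) \<midarrow>0\<rightarrow> Re (q 0)"
    by (auto simp: isCont_def intro: tendsto_Re)
  then have "0 \<le> Re (q 0)"
  proof (rule tendsto_lowerbound)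
    show "\<forall>\<^sub>F z in at 0. 0 \<le> Re (q z)"
      using eventually_at_ball'[of 1 "0::complex" UNIV] by (auto elim!: eventually_mono intro: nn)
  qed auto
  with nn q show ?thesis
    by (intro that[of q]) (auto simp: algebra_simps)
qed

text \<open>An upper bound on a zero-free function yields a lower one: ln K + ln |f(0)| - ln |f| is
  a nonnegative harmonic function with value ln K at 0, so Harnack's inequality bounds it from above
  on the smaller disc.\<close>

lemma holomorphic_Harnack_nonvanishing:
  assumes R: "0 < R" and hol: "f holomorphic_on ball 0 R"
    and nz: "\<And>z. z \<in> ball 0 R \<Longrightarrow> f z \<noteq> 0"
    and bound: "\<And>z. z \<in> ball 0 R \<Longrightarrow> norm (f z) \<le> K * norm (f 0)"
    and K: "1 \<le> K" and z: "norm z \<le> r" and r: "r < R"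
  shows "exp (ln K - ln K * (R + r) / (R - r)) * norm (f 0) \<le> norm (f z)"
proof -
  have "\<exists>h. h holomorphic_on ball 0 R \<and> (\<forall>w\<in>ball 0 R. f w = exp (h w))"
    using holomorphic_logarithm_exists[of "ball 0 R" f 0] hol nz R by (metis convex_ball open_ball centre_in_ball)
  then obtain h where h: "h holomorphic_on ball 0 R" "\<And>w. w \<in> ball 0 R \<Longrightarrow> f w = exp (h w)"
    by blast
  \<comment> \<open>Rescaled to the unit disc, this has nonnegative real part and the real value ln
    K at 0.\<close>
  define g where "g w = of_real (ln K) + h 0 - h (of_real R * w)" for w
  have im: "of_real R * w \<in> ball 0 R" if "w \<in> unit_disc" for w :: complex
    using that R by (simp add: norm_mult)
  have "(h \<circ> (\<lambda>w. of_real R * w)) holomorphic_on unit_disc"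
    using im by (intro holomorphic_on_compose_gen[OF _ h(1)] holomorphic_intros) auto
  then have holg: "g holomorphic_on unit_disc"
    unfolding g_def by (intro holomorphic_intros) (simp add: o_def)
  have nn: "0 \<le> Re (g w)" if "w \<in> unit_disc" for w
  proof -
    have "norm (f (of_real R * w)) \<le> K * norm (f 0)"
      using bound im that by blast
    then have "exp (Re (h (of_real R * w))) \<le> exp (ln K + Re (h 0))"
      using h(2)[OF im[OF that]] h(2)[of 0] R K by (simp add: exp_add)
    then show ?thesis by (simp add: g_def)
  qed
  define w where "w = z / of_real R"
  have r0: "0 \<le> r" using z norm_ge_zero order.trans by blast
  have w: "w \<in> unit_disc" "norm w \<le> r / R"
    using z r R r0 by (auto simp: w_def norm_divide divide_simps)
  have Rw: "of_real R * w = z" using R by (simp add: w_def)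
  have "norm (g w) * (1 - norm w) \<le> norm (g 0) * (1 + norm w)"
    by (rule Harnack_pos(1)[OF holg nn w(1)])
  also have "g 0 = of_real (ln K)" by (simp add: g_def)
  also have "norm (of_real (ln K) :: complex) = ln K" using K by simp
  finally have 1: "norm (g w) * (1 - norm w) \<le> ln K * (1 + norm w)" .
  have "norm (g w) * (1 - r / R) \<le> norm (g w) * (1 - norm w)"
    using w(2) by (intro mult_left_mono) auto
  also note 1
  also have "ln K * (1 + norm w) \<le> ln K * (1 + r / R)"
    using w(2) K by (intro mult_left_mono) auto
  finally have "norm (g w) * (1 - r / R) * R \<le> ln K * (1 + r / R) * R"
    using R by (intro mult_right_mono) auto
  then have "norm (g w) * (R - r) \<le> ln K * (R + r)"
    using R by (simp add: algebra_simps)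
  then have "norm (g w) \<le> ln K * (R + r) / (R - r)"
    using r by (simp add: pos_le_divide_eq)
  then have "Re (g w) \<le> ln K * (R + r) / (R - r)"
    using complex_Re_le_cmod order.trans by blast
  then have "Re (h z) \<ge> (ln K - ln K * (R + r) / (R - r)) + Re (h 0)"
    by (simp add: g_def Rw)
  then have "exp ((ln K - ln K * (R + r) / (R - r)) + Re (h 0)) \<le> exp (Re (h z))"
    by simp
  then show ?thesis
    using h(2)[of z] h(2)[of 0] R z r by (simp add: exp_add)
qed

text \<open>The constant is the same for all W. It comes from an upper bound K |W(0)| for |W| on the
  zero-free disc, turned into a lower bound by \<open>holomorphic_Harnack_nonvanishing\<close>. The
  requirement R > 1/2 puts the auxiliary circle of radius 1/2 inside that disc.\<close>

lemma generator_lower_bound: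
  assumes r: "0 \<le> r" "r < R" and R: "1/2 < R" "R < 1"
  obtains c where "c > 0"
    "\<And>W z. \<lbrakk>W holomorphic_on unit_disc;
      \<And>z. z \<in> unit_disc \<Longrightarrow> Re (cnj z * (W z - W 0 + cnj (W 0) * z\<^sup>2)) \<le> 0;
      \<And>z. norm z < R \<Longrightarrow> W z \<noteq> 0; norm z \<le> r\<rbrakk> \<Longrightarrow> c * norm (W 0) \<le> norm (W z)"
proof -
  \<comment> \<open>Each of W(0) and conj(W(0)) x^2 contributes at most |W(0)|, together the 2. With
    |q(0)| <= 27/2 |W(0)|, Harnack bounds the remaining term by 27/2 * 2/(1 - R) times
    |W(0)|.\<close>
  define K where "K = 2 + 27 / (1 - R)"
  have K: "1 \<le> K" using R by (simp add: K_def field_simps)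
  show ?thesis
  proof (rule that)
    show "exp (ln K - ln K * (R + r) / (R - r)) > 0" by simp
    fix W and z :: complex
    assume hol: "W holomorphic_on unit_disc"
      and isp: "\<And>z. z \<in> unit_disc \<Longrightarrow> Re (cnj z * (W z - W 0 + cnj (W 0) * z\<^sup>2)) \<le> 0"
      and nz: "\<And>z. norm z < R \<Longrightarrow> W z \<noteq> 0" and z: "norm z \<le> r"
    obtain q where q: "q holomorphic_on unit_disc" "\<And>z. z \<in> unit_disc \<Longrightarrow> 0 \<le> Re (q z)"
      "\<And>z. z \<in> unit_disc \<Longrightarrow> W z = W 0 - cnj (W 0) * z\<^sup>2 - z * q z"
      using generator_decomposition[OF hol isp] by metis
    \<comment> \<open>On |x| = 1/2 Harnack gives |x q(x)| >= |q(0)|/6, and the other two terms are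
      at most (1 + 1/4) |W(0)|. The value 27/2 below is the ratio |q(0)|/|W(0)| at which B equals
      |W(0)|.\<close>
    define B where "B = norm (q 0) / 6 - 5/4 * norm (W 0)"
    have circ: "B \<le> norm (W x)" if x: "norm x = 1/2" for x
    proof -
      have xd: "x \<in> unit_disc" using x by simp
      have "norm (q 0) / 3 \<le> norm (q x)"
        using Harnack_pos(2)[OF q(1,2) xd] x by simp
      moreover have "norm (x * q x) \<le> norm (W x) + norm (W 0) + norm (cnj (W 0) * x\<^sup>2)"
      proof -
        have "x * q x = W 0 - W x - cnj (W 0) * x\<^sup>2" using q(3)[OF xd] by simp
        also have "norm \<dots> \<le> norm (W 0 - W x) + norm (cnj (W 0) * x\<^sup>2)" by (rule norm_triangle_ineq4)
        also have "norm (W 0 - W x) \<le> norm (W 0) + norm (W x)" by (rule norm_triangle_ineq4)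
        finally show ?thesis by simp
      qed
      ultimately show ?thesis
        using x by (simp add: B_def norm_mult norm_power power2_eq_square)
    qed
    have q0: "norm (q 0) \<le> 27/2 * norm (W 0)"
    proof (rule ccontr)
      assume "\<not> ?thesis"
      then have B: "B > norm (W 0)" by (simp add: B_def)
      have Wnz: "W x \<noteq> 0" if "norm x \<le> 1/2" for x using nz that R by simp
      have cont: "(\<lambda>x. inverse (W x)) holomorphic_on cball 0 (1/2)"
        using Wnz by (intro holomorphic_intros holomorphic_on_subset[OF hol]) auto
      \<comment> \<open>Cauchy's estimate of order 0 is the maximum principle for 1/W at the
        centre.\<close>
      have "norm ((deriv ^^ 0) (\<lambda>x. inverse (W x)) 0) \<le> fact 0 * (1 / B) / (1/2) ^ 0"
      proof (rule Cauchy_inequality)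
        show "(\<lambda>x. inverse (W x)) holomorphic_on ball 0 (1/2)"
          using cont by (rule holomorphic_on_subset) auto
        show "continuous_on (cball 0 (1/2)) (\<lambda>x. inverse (W x))"
          using cont by (rule holomorphic_on_imp_continuous_on)
        fix x :: complex assume "norm (0 - x) = 1/2"
        then have "B \<le> norm (W x)" using circ by simp
        moreover have "0 < B" using B norm_ge_zero[of "W 0"] by linarith
        ultimately show "norm (inverse (W x)) \<le> 1 / B"
          by (simp add: norm_divide inverse_eq_divide frac_le)
      qed simp
      then have "inverse (norm (W 0)) \<le> inverse B" by (simp add: norm_divide inverse_eq_divide)
      moreover have "norm (W 0) > 0" using Wnz[of 0] by simp
      ultimately show False using B by (meson less_imp_inverse_less not_less)
    qed
    have bound: "norm (W x) \<le> K * norm (W 0)" if "x \<in> ball 0 R" for x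
    proof -
      have x: "norm x < R" "x \<in> unit_disc" using that R by auto
      have "norm (q x) * (1 - R) \<le> norm (q x) * (1 - norm x)"
        using x by (intro mult_left_mono) auto
      also have "\<dots> \<le> norm (q 0) * (1 + norm x)"
        by (rule Harnack_pos(1)[OF q(1,2) x(2)])
      also have "\<dots> \<le> 27/2 * norm (W 0) * 2"
        using q0 x by (intro mult_mono) auto
      finally have "norm (q x) \<le> 27 / (1 - R) * norm (W 0)"
        using R by (simp add: field_simps)
      moreover have "norm (x * q x) \<le> 1 * norm (q x)"
        unfolding norm_mult using x by (intro mult_right_mono) auto
      moreover have "norm (cnj (W 0) * x\<^sup>2) \<le> norm (W 0) * 1"
        unfolding norm_mult norm_power complex_mod_cnj using x
        by (intro mult_left_mono) (auto simp: power_le_one)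
      moreover have "norm (W x) \<le> norm (W 0) + norm (cnj (W 0) * x\<^sup>2) + norm (x * q x)"
        unfolding q(3)[OF x(2)]
        by (intro order.trans[OF norm_triangle_ineq4] add_mono norm_triangle_ineq4) auto
      ultimately show ?thesis unfolding K_def by (simp add: algebra_simps)
    qed
    show "exp (ln K - ln K * (R + r) / (R - r)) * norm (W 0) \<le> norm (W z)"
    proof (rule holomorphic_Harnack_nonvanishing[where f = W, OF _ _ _ bound K z r(2)])
      show "W holomorphic_on ball 0 R"
        using R by (intro holomorphic_on_subset[OF hol]) auto
    qed (use R nz in auto)
  qed
qed

subsection \<open>The infinitesimal generator\<close>

lemma has_vector_derivative_iff_quotient:
  "(f has_vector_derivative f') (at x within S) \<longleftrightarrow>
   ((\<lambda>y. (f y - f x) /\<^sub>R (y - x)) \<longlongrightarrow> f') (at x within S)"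
proof -
  have "norm (f y - f x - (y - x) *\<^sub>R f') / norm (y - x) = norm ((f y - f x) /\<^sub>R (y - x) - f')"
    if "y \<noteq> x" for y
  proof -
    have "(f y - f x) /\<^sub>R (y - x) - f' = inverse (y - x) *\<^sub>R (f y - f x - (y - x) *\<^sub>R f')"
      using that by (simp add: scaleR_diff_right)
    then show ?thesis by (simp add: divide_inverse mult.commute)
  qed
  then have "((\<lambda>y. norm (f y - f x - (y - x) *\<^sub>R f') / norm (y - x)) \<longlongrightarrow> 0) (at x within S) \<longleftrightarrow>
      ((\<lambda>y. norm ((f y - f x) /\<^sub>R (y - x) - f')) \<longlongrightarrow> 0) (at x within S)"
    by (intro Lim_cong_within) auto
  then show ?thesis
    unfolding has_vector_derivative_def has_derivative_iff_norm
    by (simp add: bounded_linear_scaleR_left tendsto_norm_zero_iff LIM_zero_iff)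
qed

text \<open>The chain rule read backwards: w is known only to be continuous. The Caratheodory slope
  of F divides the difference quotient of F(w) to give that of w. With an averaged flow as F, this
  differentiates orbits.\<close>

lemma has_vector_derivative_inverse_chain:
  fixes w :: "real \<Rightarrow> complex"
  assumes cont: "continuous (at t within S) w"
    and dF: "(F has_field_derivative F') (at (w t))" and nz: "F' \<noteq> 0"
    and dFw: "((\<lambda>s. F (w s)) has_vector_derivative d) (at t within S)"
  shows "(w has_vector_derivative d / F') (at t within S)"
proof -
  obtain k where k: "\<And>x. F x - F (w t) = k x * (x - w t)" "isCont k (w t)" "k (w t) = F'"
    using dF unfolding CARAT_DERIV by blast
  have kw: "((\<lambda>s. k (w s)) \<longlongrightarrow> F') (at t within S)"
    using isCont_tendsto_compose[OF k(2) cont[unfolded continuous_within]] by (simp add: k(3))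
  then have ne: "\<forall>\<^sub>F s in at t within S. k (w s) \<noteq> 0"
    using nz by (rule tendsto_imp_eventually_ne)
  have "((\<lambda>s. (F (w s) - F (w t)) /\<^sub>R (s - t)) \<longlongrightarrow> d) (at t within S)"
    using dFw by (simp add: has_vector_derivative_iff_quotient)
  then have "((\<lambda>s. ((F (w s) - F (w t)) /\<^sub>R (s - t)) / k (w s)) \<longlongrightarrow> d / F') (at t within S)"
    by (intro tendsto_divide kw nz)
  then have "((\<lambda>s. (w s - w t) /\<^sub>R (s - t)) \<longlongrightarrow> d / F') (at t within S)"
    by (rule Lim_transform_eventually) (use ne in \<open>auto elim!: eventually_mono simp: k(1) scaleR_conv_of_real\<close>)
  then show ?thesis by (simp add: has_vector_derivative_iff_quotient)
qed

locale disc_semigroup =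
  fixes \<phi> :: "real \<Rightarrow> complex \<Rightarrow> complex"
  assumes semigroup: "holomorphic_semigroup \<phi>"
begin

section \<open>Semigroup laws and equicontinuity in time\<close>

lemma holo: "t \<ge> 0 \<Longrightarrow> \<phi> t holomorphic_on unit_disc"
  and self_map: "t \<ge> 0 \<Longrightarrow> \<phi> t ` unit_disc \<subseteq> unit_disc"
  and at_0: "z \<in> unit_disc \<Longrightarrow> \<phi> 0 z = z"
  and add: "t \<ge> 0 \<Longrightarrow> s \<ge> 0 \<Longrightarrow> z \<in> unit_disc \<Longrightarrow> \<phi> (t + s) z = \<phi> t (\<phi> s z)"
  and unif: "compact K \<Longrightarrow> K \<subseteq> unit_disc \<Longrightarrow> uniform_limit K \<phi> (\<phi> 0) (at_right 0)"
  using semigroup unfolding holomorphic_semigroup_def by blast+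

lemma in_disc: "t \<ge> 0 \<Longrightarrow> z \<in> unit_disc \<Longrightarrow> \<phi> t z \<in> unit_disc"
  using self_map by blast

text \<open>The later point is the image under the earlier map of a point flowed for time |t - s|,
  and Schwarz-Pick contracts the distance. Hence continuity at time 0 spreads to all times at once.
  The factors 1/(1 - r) and 2 convert between pseudohyperbolic and Euclidean distance.\<close>

lemma orbit_increment:
  assumes z: "norm z \<le> r" "r < 1" and t: "0 \<le> s" "0 \<le> t"
  shows "norm (\<phi> t z - \<phi> s z) \<le> 2 / (1 - r) * norm (\<phi> \<bar>t - s\<bar> z - z)"
proof -
  have *: "norm (\<phi> (s + h) z - \<phi> s z) \<le> 2 / (1 - r) * norm (\<phi> h z - z)" if "s \<ge> 0" "h \<ge> 0" for s h
  proof -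
    have zd: "z \<in> unit_disc" using z by simp
    note hd = in_disc[OF that(2) zd]
    let ?a = "\<phi> s z" and ?b = "\<phi> s (\<phi> h z)"
    have ab: "?a \<in> unit_disc" "?b \<in> unit_disc" using in_disc that zd hd by auto
    have "norm (disc_shift ?a ?b) \<le> norm (disc_shift z (\<phi> h z))"
      by (rule Schwarz_Pick[OF holo self_map]) (use that zd hd in auto)
    also have "\<dots> \<le> norm (\<phi> h z - z) / (1 - r)"
    proof -
      have "norm (cnj z * \<phi> h z) \<le> r * 1"
        unfolding norm_mult using z hd by (intro mult_mono) (auto intro: order.trans[OF norm_ge_zero])
      then have "1 - r \<le> norm (1 - cnj z * \<phi> h z)"
        using norm_triangle_ineq2[of 1 "cnj z * \<phi> h z"] by simp
      then show ?thesis
        unfolding Moebius_function_simple using z by (simp add: norm_divide frac_le)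
    qed
    finally have 1: "norm (disc_shift ?a ?b) \<le> norm (\<phi> h z - z) / (1 - r)" .
    have "norm (cnj ?a * ?b) \<le> 1 * 1"
      unfolding norm_mult using ab by (intro mult_mono) auto
    then have 2: "norm (1 - cnj ?a * ?b) \<le> 2"
      using norm_triangle_ineq4[of 1 "cnj ?a * ?b"] by simp
    have "1 - cnj ?a * ?b \<noteq> 0" using one_minus_cnj_mult_nonzero ab by simp
    then have "norm (?b - ?a) = norm (disc_shift ?a ?b) * norm (1 - cnj ?a * ?b)"
      by (simp add: Moebius_function_simple norm_divide)
    also have "\<dots> \<le> norm (\<phi> h z - z) / (1 - r) * 2"
      using 1 2 z by (intro mult_mono) auto
    finally show ?thesis using add[OF that zd] by (simp add: mult.commute)
  qed
  show ?thesis
  proof (cases "s \<le> t")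
    case True
    then show ?thesis using *[of s "t - s"] t by simp
  next
    case False
    then show ?thesis using *[of t "s - t"] t by (simp add: norm_minus_commute)
  qed
qed

lemma equicontinuous:
  assumes "r < 1" "e > 0"
  obtains d where "d > 0"
    "\<And>z s t. \<lbrakk>norm z \<le> r; 0 \<le> s; 0 \<le> t; \<bar>t - s\<bar> < d\<rbrakk> \<Longrightarrow> norm (\<phi> t z - \<phi> s z) < e"
proof -
  have "uniform_limit (cball 0 r) \<phi> (\<phi> 0) (at_right 0)"
    using assms by (intro unif) auto
  then have "\<forall>\<^sub>F t in at_right 0. \<forall>z\<in>cball 0 r. dist (\<phi> t z) (\<phi> 0 z) < e * (1 - r) / 2"
    using assms by (intro uniform_limitD) auto
  then obtain d where d: "d > 0" "\<And>t. 0 < t \<Longrightarrow> t < d \<Longrightarrow> \<forall>z\<in>cball 0 r. dist (\<phi> t z) (\<phi> 0 z) < e * (1 - r) / 2"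
    unfolding eventually_at_right_field by auto
  show ?thesis
  proof (rule that[OF d(1)])
    fix z :: complex and s t :: real assume a: "norm z \<le> r" "0 \<le> s" "0 \<le> t" "\<bar>t - s\<bar> < d"
    have zd: "z \<in> unit_disc" using a assms by simp
    have "norm (\<phi> \<bar>t - s\<bar> z - z) < e * (1 - r) / 2"
    proof (cases "t = s")
      case True
      then show ?thesis using assms at_0[OF zd] by simp
    next
      case False
      then have "dist (\<phi> \<bar>t - s\<bar> z) (\<phi> 0 z) < e * (1 - r) / 2"
        using d(2)[of "\<bar>t - s\<bar>"] a by auto
      then show ?thesis using at_0[OF zd] by (simp add: dist_norm)
    qed
    then have "2 / (1 - r) * norm (\<phi> \<bar>t - s\<bar> z - z) < e"
      using assms by (simp add: field_simps)
    then show "norm (\<phi> t z - \<phi> s z) < e"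
      using orbit_increment[OF a(1) assms(1) a(2,3)] by simp
  qed
qed

lemma continuous_orbit:
  assumes "z \<in> unit_disc"
  shows "continuous_on {0..} (\<lambda>t. \<phi> t z)"
  unfolding continuous_on_iff
proof (intro ballI allI impI)
  fix s e :: real assume "s \<in> {0..}" "e > 0"
  obtain d where "d > 0"
    "\<And>w s t. \<lbrakk>norm w \<le> norm z; 0 \<le> s; 0 \<le> t; \<bar>t - s\<bar> < d\<rbrakk> \<Longrightarrow> norm (\<phi> t w - \<phi> s w) < e"
    using equicontinuous[of "norm z" e] assms \<open>e > 0\<close> by auto
  then show "\<exists>d>0. \<forall>t\<in>{0..}. dist t s < d \<longrightarrow> dist (\<phi> t z) (\<phi> s z) < e"
    using \<open>s \<in> {0..}\<close> by (intro exI[of _ d]) (auto simp: dist_norm)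
qed

text \<open>Cauchy's estimate turns equicontinuity in time into closeness of derivatives. Joint
  continuity is what differentiation under the integral sign requires.\<close>

lemma continuous_deriv:
  "continuous_on (unit_disc \<times> {0..}) (\<lambda>(z, t). deriv (\<phi> t) z)"
  unfolding continuous_on_iff
proof (intro ballI allI impI, clarify)
  fix z :: complex and s e :: real assume z: "z \<in> unit_disc" and s: "s \<ge> 0" and e: "e > 0"
  \<comment> \<open>One third, because w may be off z by \<rho> and the Cauchy circle about w adds
    another \<rho>, which must leave distance \<rho> to the unit circle.\<close>
  define \<rho> where "\<rho> = (1 - norm z) / 3"
  have \<rho>: "\<rho> > 0" using z by (simp add: \<rho>_def)
  have "continuous_on unit_disc (deriv (\<phi> s))"
    by (intro holomorphic_on_imp_continuous_on holomorphic_deriv holo s) auto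
  then obtain d1 where d1: "d1 > 0" "\<And>w. w \<in> unit_disc \<Longrightarrow> dist w z < d1 \<Longrightarrow> dist (deriv (\<phi> s) w) (deriv (\<phi> s) z) < e / 2"
    unfolding continuous_on_iff using z e by (meson half_gt_zero)
  obtain d2 where d2: "d2 > 0"
    "\<And>w s t. \<lbrakk>norm w \<le> 1 - \<rho>; 0 \<le> s; 0 \<le> t; \<bar>t - s\<bar> < d2\<rbrakk> \<Longrightarrow> norm (\<phi> t w - \<phi> s w) < e * \<rho> / 4"
    using equicontinuous[of "1 - \<rho>" "e * \<rho> / 4"] \<rho> e by auto
  have "dist (deriv (\<phi> t) w) (deriv (\<phi> s) z) < e"
    if t: "t \<ge> 0" and near: "dist (w, t) (z, s) < min (min d1 d2) \<rho>" for w t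
  proof -
    have "dist w z \<le> dist (w, t) (z, s)" "dist t s \<le> dist (w, t) (z, s)"
      using dist_fst_le[of "(w, t)" "(z, s)"] dist_snd_le[of "(w, t)" "(z, s)"] by auto
    then have dw: "dist w z < d1" "dist w z < \<rho>" and dt: "\<bar>t - s\<bar> < d2"
      using near by (auto simp: dist_real_def)
    have inner: "norm x \<le> 1 - \<rho>" if "norm (w - x) \<le> \<rho>" for x
    proof -
      have "norm x \<le> norm z + norm (w - z) + norm (w - x)"
        using norm_triangle_ineq4[of "z + (w - z)" "w - x"] norm_triangle_ineq[of z "w - z"] by simp
      also have "\<dots> \<le> norm z + \<rho> + \<rho>" using dw that by (simp add: dist_norm)
      also have "\<dots> = 1 - \<rho>" by (simp add: \<rho>_def field_simps)
      finally show ?thesis .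
    qed
    have sub: "cball w \<rho> \<subseteq> unit_disc"
    proof
      fix x assume "x \<in> cball w \<rho>"
      then have "norm x \<le> 1 - \<rho>" using inner by (simp add: dist_norm)
      then show "x \<in> unit_disc" using \<rho> by simp
    qed
    then have wd: "w \<in> unit_disc" using \<rho> by (meson centre_in_cball less_imp_le subsetD)
    have hol: "(\<lambda>x. \<phi> t x - \<phi> s x) holomorphic_on unit_disc"
      by (intro holomorphic_intros holo t s)
    have "norm ((deriv ^^ 1) (\<lambda>x. \<phi> t x - \<phi> s x) w) \<le> fact 1 * (e * \<rho> / 4) / \<rho> ^ 1"
    proof (rule Cauchy_inequality)
      show "(\<lambda>x. \<phi> t x - \<phi> s x) holomorphic_on ball w \<rho>"
        using sub ball_subset_cball by (intro holomorphic_on_subset[OF hol]) blast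
      show "continuous_on (cball w \<rho>) (\<lambda>x. \<phi> t x - \<phi> s x)"
        by (intro holomorphic_on_imp_continuous_on holomorphic_on_subset[OF hol] sub)
      show "norm (\<phi> t x - \<phi> s x) \<le> e * \<rho> / 4" if "norm (w - x) = \<rho>" for x
        using d2(2)[of x s t] inner[of x] that s t dt by force
    qed (rule \<rho>)
    moreover have "deriv (\<lambda>x. \<phi> t x - \<phi> s x) w = deriv (\<phi> t) w - deriv (\<phi> s) w"
      by (intro deriv_diff holomorphic_on_imp_differentiable_at[OF holo open_ball wd] s t)
    ultimately have "norm (deriv (\<phi> t) w - deriv (\<phi> s) w) \<le> e / 4"
      using \<rho> by simp
    moreover have "norm (deriv (\<phi> s) w - deriv (\<phi> s) z) < e / 2"
      using d1(2)[OF wd dw(1)] by (simp add: dist_norm)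
    ultimately have "norm ((deriv (\<phi> t) w - deriv (\<phi> s) w) + (deriv (\<phi> s) w - deriv (\<phi> s) z)) < e"
      using e by (intro order.strict_trans1[OF norm_triangle_ineq]) simp
    then show ?thesis by (simp add: dist_norm)
  qed
  then have "\<forall>x'\<in>unit_disc \<times> {0..}. dist x' (z, s) < min (min d1 d2) \<rho> \<longrightarrow>
      dist (case x' of (z, t) \<Rightarrow> deriv (\<phi> t) z) (deriv (\<phi> s) z) < e"
    by (intro ballI impI) (clarsimp simp only: prod.case mem_Times_iff split_paired_all fst_conv snd_conv atLeast_iff)
  moreover have "min (min d1 d2) \<rho> > 0" using d1(1) d2(1) \<rho> by simp
  ultimately show "\<exists>d>0. \<forall>x'\<in>unit_disc \<times> {0..}. dist x' (z, s) < d \<longrightarrow>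
      dist (case x' of (z, t) \<Rightarrow> deriv (\<phi> t) z) (deriv (\<phi> s) z) < e"
    by blast
qed

section \<open>Smoothing in time and differentiability of the orbits\<close>

definition mean_orbit :: "real \<Rightarrow> complex \<Rightarrow> complex" where
  "mean_orbit \<epsilon> z = integral {0..\<epsilon>} (\<lambda>s. \<phi> s z)"

definition mean_deriv :: "real \<Rightarrow> complex \<Rightarrow> complex" where
  "mean_deriv \<epsilon> z = integral {0..\<epsilon>} (\<lambda>s. deriv (\<phi> s) z)"

lemma has_field_derivative_mean_orbit:
  assumes "z \<in> unit_disc"
  shows "(mean_orbit \<epsilon> has_field_derivative mean_deriv \<epsilon> z) (at z)"
proof -
  have "((\<lambda>z. integral (cbox 0 \<epsilon>) (\<lambda>s. \<phi> s z)) has_field_derivative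
      integral (cbox 0 \<epsilon>) (\<lambda>s. deriv (\<phi> s) z)) (at z within unit_disc)"
  proof (rule leibniz_rule_field_derivative[where f = "\<lambda>z s. \<phi> s z" and fx = "\<lambda>z s. deriv (\<phi> s) z"])
    show "((\<lambda>x. \<phi> t x) has_field_derivative deriv (\<phi> t) x) (at x within unit_disc)"
      if "x \<in> unit_disc" "t \<in> cbox 0 \<epsilon>" for x t
      by (rule holomorphic_derivI[OF holo open_ball]) (use that in auto)
    show "(\<lambda>s. \<phi> s x) integrable_on cbox 0 \<epsilon>" if "x \<in> unit_disc" for x
      using continuous_on_subset[OF continuous_orbit[OF that]] by (intro integrable_continuous) auto
    show "continuous_on (unit_disc \<times> cbox 0 \<epsilon>) (\<lambda>(x, t). deriv (\<phi> t) x)"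
      by (rule continuous_on_subset[OF continuous_deriv]) auto
  qed (use assms in auto)
  then show ?thesis
    unfolding mean_orbit_def[abs_def] mean_deriv_def interval_cbox at_within_open[OF assms open_ball] .
qed

text \<open>Divided by \<epsilon>, the averaged derivative tends to the derivative 1 of the
  identity. The choice of \<epsilon> depends on z.\<close>

lemma mean_deriv_nonzero:
  assumes "z \<in> unit_disc"
  obtains \<epsilon> where "\<epsilon> > 0" "mean_deriv \<epsilon> z \<noteq> 0"
proof -
  have "continuous_on {0..1} (\<lambda>s. case (z, s) of (z, t) \<Rightarrow> deriv (\<phi> t) z)"
    by (rule continuous_on_compose2[OF continuous_deriv]) (use assms in \<open>auto intro!: continuous_intros\<close>)
  then have cont: "continuous_on {0..1} (\<lambda>s. deriv (\<phi> s) z)" by simp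
  \<comment> \<open>Outside the disc \<open>\<phi> 0\<close> is arbitrary, so its derivative is
    computed from its values near z.\<close>
  have "eventually (\<lambda>w. w \<in> unit_disc) (nhds z)"
    using assms by (intro eventually_nhds_in_open) auto
  then have "deriv (\<phi> 0) z = deriv (\<lambda>w. w) z"
    by (intro deriv_cong_ev) (auto elim!: eventually_mono simp: at_0)
  then have d1: "deriv (\<phi> 0) z = 1" by simp
  have "((\<lambda>\<epsilon>. integral {0..\<epsilon>} (\<lambda>s. deriv (\<phi> s) z)) has_vector_derivative deriv (\<phi> 0) z) (at 0 within {0..1})"
    by (rule integral_has_vector_derivative[OF cont]) auto
  then have "((\<lambda>\<epsilon>. mean_deriv \<epsilon> z) has_vector_derivative 1) (at 0 within {0..1})"
    unfolding mean_deriv_def d1 .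
  then have "((\<lambda>\<epsilon>. (mean_deriv \<epsilon> z - mean_deriv 0 z) /\<^sub>R (\<epsilon> - 0)) \<longlongrightarrow> 1) (at 0 within {0..1})"
    by (simp add: has_vector_derivative_iff_quotient)
  then have "\<forall>\<^sub>F \<epsilon> in at 0 within {0..1}. (mean_deriv \<epsilon> z - mean_deriv 0 z) /\<^sub>R (\<epsilon> - 0) \<noteq> 0"
    by (rule tendsto_imp_eventually_ne) simp
  then have "\<forall>\<^sub>F \<epsilon> in at 0 within {0..1}. 0 < \<epsilon> \<and> mean_deriv \<epsilon> z \<noteq> 0"
    by (auto simp: eventually_at_filter mean_deriv_def elim!: eventually_mono)
  moreover have "at (0::real) within {0..1} \<noteq> bot"
    by (simp add: at_within_Icc_at_right)
  ultimately have "\<exists>\<epsilon>. 0 < \<epsilon> \<and> mean_deriv \<epsilon> z \<noteq> 0"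
    by (rule eventually_happens'[rotated])
  then show ?thesis using that by blast
qed

text \<open>The generator is read off from \<open>mean_orbit\<close>, whose composition with an orbit is
  differentiable in time even before the orbit itself is known to be.\<close>

lemma has_vector_derivative_mean_orbit:
  assumes z: "z \<in> unit_disc" and t: "t \<ge> 0" and e: "\<epsilon> > 0"
  shows "((\<lambda>s. mean_orbit \<epsilon> (\<phi> s z)) has_vector_derivative (\<phi> \<epsilon> (\<phi> t z) - \<phi> t z)) (at t within {0..})"
proof -
  \<comment> \<open>The fundamental theorem of calculus is applied on compact time intervals; any
    endpoint beyond t gives the same filter at t as the half-line.\<close>
  define b where "b = t + 1"
  define I where "I u = integral {0..u} (\<lambda>s. \<phi> s z)" for u
  have cont: "continuous_on {a..c} (\<lambda>s. \<phi> s z)" if "a \<ge> 0" for a c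
    by (rule continuous_on_subset[OF continuous_orbit[OF z]]) (use that in auto)
  have dI: "(I has_vector_derivative \<phi> u z) (at u within {0..B})" if "u \<in> {0..B}" for u B
    unfolding I_def by (rule integral_has_vector_derivative[OF cont that]) simp
  \<comment> \<open>By the semigroup law the average started at time s is an integral over the
    window from s to s + \<epsilon>, so s enters only through the limits of integration.\<close>
  have eq: "mean_orbit \<epsilon> (\<phi> s z) = I (s + \<epsilon>) - I s" if "s \<ge> 0" for s
  proof -
    have "mean_orbit \<epsilon> (\<phi> s z) = integral {0..\<epsilon>} ((\<lambda>u. \<phi> u z) \<circ> (\<lambda>u. u + s))"
      unfolding mean_orbit_def using that z by (intro integral_cong) (simp add: add)
    also have "\<dots> = integral {0 + s..\<epsilon> + s} (\<lambda>u. \<phi> u z)"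
      by (rule integral_shift[OF cont]) (use that in auto)
    also have "\<dots> = I (s + \<epsilon>) - I s"
    proof -
      have "I s + integral {s..s + \<epsilon>} (\<lambda>u. \<phi> u z) = I (s + \<epsilon>)"
        unfolding I_def
        by (rule Henstock_Kurzweil_Integration.integral_combine) (use that e in \<open>auto intro!: integrable_continuous_real cont\<close>)
      then show ?thesis by (simp add: algebra_simps)
    qed
    finally show ?thesis .
  qed
  have "((I \<circ> (\<lambda>s. s + \<epsilon>)) has_vector_derivative 1 *\<^sub>R \<phi> (t + \<epsilon>) z) (at t within {0..b})"
  proof (rule vector_diff_chain_within)
    show "((\<lambda>s. s + \<epsilon>) has_vector_derivative 1) (at t within {0..b})"
      by (auto intro!: derivative_eq_intros)
    have "(I has_vector_derivative \<phi> (t + \<epsilon>) z) (at (t + \<epsilon>) within {0..b + \<epsilon>})"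
      by (rule dI) (use t e in \<open>auto simp: b_def\<close>)
    then show "(I has_vector_derivative \<phi> (t + \<epsilon>) z) (at (t + \<epsilon>) within (\<lambda>s. s + \<epsilon>) ` {0..b})"
      by (rule has_vector_derivative_within_subset) (use e in auto)
  qed
  then have "((\<lambda>s. I (s + \<epsilon>) - I s) has_vector_derivative (\<phi> (t + \<epsilon>) z - \<phi> t z)) (at t within {0..b})"
    by (intro derivative_intros dI) (use t in \<open>auto simp: b_def o_def\<close>)
  then have "((\<lambda>s. mean_orbit \<epsilon> (\<phi> s z)) has_vector_derivative (\<phi> (t + \<epsilon>) z - \<phi> t z)) (at t within {0..b})"
    by (rule has_vector_derivative_transform[rotated 2]) (use t eq in \<open>auto simp: b_def\<close>)
  moreover have "at t within {0..b} = at t within {0..}"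
  proof (rule at_within_nhd[of _ "{..<b}"])
    show "{0..b} \<inter> {..<b} - {t} = {0..} \<inter> {..<b} - {t}" by auto
  qed (auto simp: b_def)
  moreover have "\<phi> (t + \<epsilon>) z = \<phi> \<epsilon> (\<phi> t z)"
    using add[of \<epsilon> t z] t e z by (simp add: add.commute)
  ultimately show ?thesis by simp
qed

definition generator :: "complex \<Rightarrow> complex" where
  "generator z = vector_derivative (\<lambda>t. \<phi> t z) (at 0 within {0..})"

lemma has_vector_derivative_orbit_aux:
  assumes z: "z \<in> unit_disc" and t: "t \<ge> 0" and e: "\<epsilon> > 0" and nz: "mean_deriv \<epsilon> (\<phi> t z) \<noteq> 0"
  shows "((\<lambda>s. \<phi> s z) has_vector_derivative
    (\<phi> \<epsilon> (\<phi> t z) - \<phi> t z) / mean_deriv \<epsilon> (\<phi> t z)) (at t within {0..})"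
proof (rule has_vector_derivative_inverse_chain[where F = "mean_orbit \<epsilon>" and w = "\<lambda>s. \<phi> s z", OF _ _ nz has_vector_derivative_mean_orbit[OF z t e]])
  show "continuous (at t within {0..}) (\<lambda>s. \<phi> s z)"
    using continuous_orbit[OF z] t by (simp add: continuous_on_eq_continuous_within)
  show "(mean_orbit \<epsilon> has_field_derivative mean_deriv \<epsilon> (\<phi> t z)) (at (\<phi> t z))"
    by (rule has_field_derivative_mean_orbit[OF in_disc[OF t z]])
qed

lemma generator_eq:
  assumes z: "z \<in> unit_disc" and e: "\<epsilon> > 0" and nz: "mean_deriv \<epsilon> z \<noteq> 0"
  shows "generator z = (\<phi> \<epsilon> z - z) / mean_deriv \<epsilon> z"
proof -
  have "((\<lambda>s. \<phi> s z) has_vector_derivative (\<phi> \<epsilon> z - z) / mean_deriv \<epsilon> z) (at 0 within {0..})"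
    using has_vector_derivative_orbit_aux[OF z, of 0 \<epsilon>] e nz at_0[OF z] by simp
  then show ?thesis
    unfolding generator_def
    by (rule vector_derivative_within[rotated]) (simp add: at_within_Ici_at_right)
qed

lemma has_vector_derivative_orbit:
  assumes z: "z \<in> unit_disc" and t: "t \<ge> 0"
  shows "((\<lambda>s. \<phi> s z) has_vector_derivative generator (\<phi> t z)) (at t within {0..})"
proof -
  obtain \<epsilon> where "\<epsilon> > 0" "mean_deriv \<epsilon> (\<phi> t z) \<noteq> 0"
    using mean_deriv_nonzero[OF in_disc[OF t z]] .
  then show ?thesis
    using has_vector_derivative_orbit_aux[OF z t] generator_eq[OF in_disc[OF t z]] by simp
qed

text \<open>Near each point a single \<epsilon> works, and \<open>generator_eq\<close> exhibits the
  generator as a quotient of holomorphic functions; the denominator is holomorphic as the derivative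
  of \<open>mean_orbit\<close>.\<close>

lemma holomorphic_generator: "generator holomorphic_on unit_disc"
proof -
  have "generator field_differentiable (at z within unit_disc)" if z: "z \<in> unit_disc" for z
  proof -
    obtain \<epsilon> where e: "\<epsilon> > 0" "mean_deriv \<epsilon> z \<noteq> 0"
      using mean_deriv_nonzero[OF z] .
    have "mean_orbit \<epsilon> holomorphic_on unit_disc"
      unfolding holomorphic_on_open[OF open_ball] using has_field_derivative_mean_orbit by blast
    then have "deriv (mean_orbit \<epsilon>) holomorphic_on unit_disc"
      by (rule holomorphic_deriv) simp
    then have hol: "mean_deriv \<epsilon> holomorphic_on unit_disc"
      by (rule holomorphic_transform) (metis DERIV_imp_deriv has_field_derivative_mean_orbit)
    then have "open (unit_disc \<inter> mean_deriv \<epsilon> -` (- {0}))"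
      by (intro continuous_open_preimage holomorphic_on_imp_continuous_on) auto
    then obtain S where S: "open S" "z \<in> S" "S \<subseteq> unit_disc" "\<And>w. w \<in> S \<Longrightarrow> mean_deriv \<epsilon> w \<noteq> 0"
      using that[of "unit_disc \<inter> mean_deriv \<epsilon> -` (- {0})"] z e by auto
    have "(\<lambda>w. (\<phi> \<epsilon> w - w) / mean_deriv \<epsilon> w) holomorphic_on S"
      using S e by (intro holomorphic_intros holomorphic_on_subset[OF hol] holomorphic_on_subset[OF holo]) auto
    then have "generator holomorphic_on S"
      by (rule holomorphic_transform) (use S e generator_eq in auto)
    then show ?thesis
      using S(1,2) holomorphic_on_imp_differentiable_at field_differentiable_at_within by blast
  qed
  then show ?thesis by (simp add: holomorphic_on_def)
qed

text \<open>Two orbits cannot merge, because \<open>exp (2 * L * t)\<close> times their squared distance is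
  increasing when the generator is \<open>L\<close>-Lipschitz near both orbit segments.\<close>

lemma inj_on_semigroup:
  assumes T: "T \<ge> 0"
  shows "inj_on (\<phi> T) unit_disc"
proof (rule inj_onI)
  fix x y assume x: "x \<in> unit_disc" and y: "y \<in> unit_disc" and eq: "\<phi> T x = \<phi> T y"
  have cont: "continuous_on {0..T} (\<lambda>t. \<phi> t z)" if "z \<in> unit_disc" for z
    by (rule continuous_on_subset[OF continuous_orbit[OF that]]) auto
  define K where "K = (\<lambda>t. \<phi> t x) ` {0..T} \<union> (\<lambda>t. \<phi> t y) ` {0..T}"
  have K: "compact K" "K \<subseteq> unit_disc"
    unfolding K_def using in_disc x y by (auto intro!: compact_Un compact_continuous_image cont)
  \<comment> \<open>A closed ball around both orbit segments is convex, so a bound on the derivative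
    of the generator becomes a Lipschitz bound.\<close>
  obtain r where r: "r < 1" "K \<subseteq> cball 0 r"
  proof -
    obtain w where w: "w \<in> K" "\<And>v. v \<in> K \<Longrightarrow> norm v \<le> norm w"
      using continuous_attains_sup[OF K(1) _ continuous_on_norm_id] T unfolding K_def by auto
    show ?thesis using w K(2) by (intro that[of "norm w"]) auto
  qed
  have sub: "cball 0 r \<subseteq> unit_disc" using r by auto
  have "continuous_on (cball 0 r) (deriv generator)"
    by (intro holomorphic_on_imp_continuous_on holomorphic_on_subset[OF _ sub] holomorphic_deriv
        holomorphic_generator open_ball)
  then have "bounded (deriv generator ` cball 0 r)"
    by (intro compact_imp_bounded compact_continuous_image) auto
  then obtain L where "\<forall>v \<in> deriv generator ` cball 0 r. norm v \<le> L"
    unfolding bounded_iff by blast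
  then have L: "norm (deriv generator z) \<le> L" if "z \<in> cball 0 r" for z
    using that by blast
  have lip: "norm (generator v - generator w) \<le> L * norm (v - w)" if "v \<in> cball 0 r" "w \<in> cball 0 r" for v w
  proof (rule field_differentiable_bound[OF convex_cball _ L that])
    fix z :: complex assume "z \<in> cball 0 r"
    then show "(generator has_field_derivative deriv generator z) (at z within cball 0 r)"
      using sub by (intro holomorphic_derivI[OF holomorphic_generator open_ball]) auto
  qed
  define d where "d t = \<phi> t x - \<phi> t y" for t
  define u where "u t = exp (2 * L * t) * (d t \<bullet> d t)" for t
  have orbit: "\<phi> t x \<in> cball 0 r" "\<phi> t y \<in> cball 0 r" if "t \<in> {0..T}" for t
    using r(2) that unfolding K_def by blast+
  have "u 0 \<le> u T"
  proof (rule DERIV_nonneg_imp_increasing_open[OF T])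
    show "continuous_on {0..T} u"
      unfolding u_def d_def by (intro continuous_intros cont x y)
    fix t assume t: "0 < t" "t < T"
    define d' where "d' = generator (\<phi> t x) - generator (\<phi> t y)"
    have "at t within {0..} = at t"
      using t by (intro at_within_interior) simp
    then have dd: "(d has_vector_derivative d') (at t)"
      using has_vector_derivative_diff[OF has_vector_derivative_orbit[OF x, of t] has_vector_derivative_orbit[OF y, of t]] t
      unfolding d_def d'_def by simp
    have "((\<lambda>t. d t \<bullet> d t) has_real_derivative (d t \<bullet> d' + d' \<bullet> d t)) (at t)"
      using bounded_bilinear.has_vector_derivative[OF bounded_bilinear_inner dd dd]
      by (simp add: has_real_derivative_iff_has_vector_derivative)
    then have "(u has_real_derivative
        (exp (2 * L * t) * (2 * L)) * (d t \<bullet> d t) + (d t \<bullet> d' + d' \<bullet> d t) * exp (2 * L * t)) (at t)"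
      unfolding u_def by (intro DERIV_mult) (auto intro!: derivative_eq_intros)
    moreover have "(exp (2 * L * t) * (2 * L)) * (d t \<bullet> d t) + (d t \<bullet> d' + d' \<bullet> d t) * exp (2 * L * t)
        = 2 * exp (2 * L * t) * (L * (d t \<bullet> d t) + d t \<bullet> d')"
      by (simp add: algebra_simps inner_commute)
    moreover have "0 \<le> L * (d t \<bullet> d t) + d t \<bullet> d'"
    proof -
      have "\<bar>d t \<bullet> d'\<bar> \<le> norm (d t) * norm d'" by (rule Cauchy_Schwarz_ineq2)
      also have "\<dots> \<le> norm (d t) * (L * norm (d t))"
        using lip[OF orbit[of t]] t by (intro mult_left_mono) (auto simp: d_def d'_def)
      also have "\<dots> = L * (d t \<bullet> d t)"
        by (simp add: power2_norm_eq_inner[symmetric] power2_eq_square)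
      finally show ?thesis by simp
    qed
    ultimately show "\<exists>D. (u has_real_derivative D) (at t) \<and> 0 \<le> D"
      by (intro exI[of _ "2 * exp (2 * L * t) * (L * (d t \<bullet> d t) + d t \<bullet> d')"] conjI) auto
  qed
  then have "d 0 \<bullet> d 0 \<le> 0" using eq by (simp add: u_def d_def)
  then have "d 0 = 0" using inner_ge_zero[of "d 0"] by (metis inner_eq_zero_iff order_antisym)
  then show "x = y" using at_0 x y by (simp add: d_def)
qed

end

subsection \<open>Linearization and the bound on the generator\<close>

text \<open>The two factors are the derivatives of \<open>disc_shift p\<close> and of its inverse
  \<open>disc_shift (-p)\<close> at corresponding points.\<close>

lemma disc_shift_deriv_inverse:
  assumes p: "p \<in> unit_disc" and z: "z \<in> unit_disc"
  shows "of_real (1 - (norm p)\<^sup>2) / (1 - cnj p * disc_shift (-p) z)\<^sup>2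
    * (of_real (1 - (norm p)\<^sup>2) / (1 + cnj p * z)\<^sup>2) = (1 :: complex)"
proof -
  have nz: "1 + cnj p * z \<noteq> 0"
    using one_minus_cnj_mult_nonzero[of "-p" z] p z by simp
  have pp: "of_real (1 - (norm p)\<^sup>2) = 1 - cnj p * p"
    by (simp only: of_real_diff of_real_1 complex_norm_square mult.commute)
  have nz2: "1 - cnj p * p \<noteq> 0"
    using one_minus_cnj_mult_nonzero[of p p] p by simp
  have "1 - cnj p * disc_shift (-p) z = (1 - cnj p * p) / (1 + cnj p * z)"
    using nz by (simp add: Moebius_function_simple field_simps)
  then show ?thesis
    unfolding pp using nz nz2 by (simp only: power_divide) (simp add: power2_eq_square)
qed

section \<open>The generator in a coordinate centred at p\<close>

context disc_semigroup
begin

text \<open>The vector field \<open>generator\<close> in the coordinate \<open>disc_shift p\<close>: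
  its value is multiplied by the derivative of the coordinate change. It generates the conjugated
  semigroup and is the W of the overview.\<close>

definition pullback :: "complex \<Rightarrow> complex \<Rightarrow> complex" where
  "pullback p z = generator (disc_shift (-p) z)
     * (of_real (1 - (norm p)\<^sup>2) / (1 - cnj p * disc_shift (-p) z)\<^sup>2)"

lemma holomorphic_pullback:
  assumes p: "p \<in> unit_disc"
  shows "pullback p holomorphic_on unit_disc"
proof -
  have m: "disc_shift (-p) holomorphic_on unit_disc"
    using p by (intro Moebius_function_holomorphic) simp
  have im: "disc_shift (-p) ` unit_disc \<subseteq> unit_disc"
    using p disc_shift_in_disc[of "-p"] by auto
  have "(generator \<circ> disc_shift (-p)) holomorphic_on unit_disc"
    by (rule holomorphic_on_compose_gen[OF m holomorphic_generator im])
  moreover have "1 - cnj p * disc_shift (-p) z \<noteq> 0" if "z \<in> unit_disc" for z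
    using one_minus_cnj_mult_nonzero[of p "disc_shift (-p) z"] p disc_shift_in_disc[of "-p" z] that by simp
  ultimately show ?thesis
    unfolding pullback_def[abs_def] o_def by (intro holomorphic_intros m) auto
qed

lemma pullback_disc_shift:
  assumes "p \<in> unit_disc" "z \<in> unit_disc"
  shows "pullback p (disc_shift p z) = generator z * (of_real (1 - (norm p)\<^sup>2) / (1 - cnj p * z)\<^sup>2)"
  using disc_shift_inverse(2)[OF assms] by (simp add: pullback_def)

lemma pullback_eq_0_iff:
  assumes p: "p \<in> unit_disc" and z: "z \<in> unit_disc"
  shows "pullback p z = 0 \<longleftrightarrow> generator (disc_shift (-p) z) = 0"
  using disc_shift_deriv_inverse[OF p z] unfolding pullback_def
  by (metis mult_eq_0_iff zero_neq_one)

text \<open>The modulus of this value is the hyperbolic speed of the flow at p.\<close>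

lemma pullback_0:
  assumes "p \<in> unit_disc"
  shows "pullback p 0 = generator p / of_real (1 - (norm p)\<^sup>2)"
proof -
  have "cnj p * p = of_real ((norm p)\<^sup>2)"
    by (simp only: complex_norm_square mult.commute)
  moreover have "disc_shift (-p) 0 = p" by (simp add: Moebius_function_of_zero)
  ultimately show ?thesis
    by (simp add: pullback_def power2_eq_square[of "1 - _ :: complex"])
qed

lemma has_vector_derivative_shifted_orbit:
  assumes p: "p \<in> unit_disc" and z: "z \<in> unit_disc" and t: "t \<ge> 0"
  shows "((\<lambda>s. disc_shift p (\<phi> s z)) has_vector_derivative pullback p (disc_shift p (\<phi> t z))) (at t within {0..})"
proof -
  have "((disc_shift p \<circ> (\<lambda>s. \<phi> s z)) has_vector_derivative
      generator (\<phi> t z) * (of_real (1 - (norm p)\<^sup>2) / (1 - cnj p * \<phi> t z)\<^sup>2)) (at t within {0..})"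
    using has_field_derivative_disc_shift[OF p in_disc[OF t z]]
    by (intro field_vector_diff_chain_within has_vector_derivative_orbit z t)
      (simp add: has_field_derivative_at_within)
  then show ?thesis
    by (simp add: o_def pullback_disc_shift[OF p in_disc[OF t z]])
qed

lemma pullback_infinitesimal_Schwarz_Pick:
  assumes p: "p \<in> unit_disc" and z: "z \<in> unit_disc"
  shows "Re (cnj z * (pullback p z - pullback p 0 + cnj (pullback p 0) * z\<^sup>2)) \<le> 0"
proof (rule infinitesimal_Schwarz_Pick[OF _ _ _ z, where f = "\<lambda>t z. disc_shift p (\<phi> t (disc_shift (-p) z))"])
  have p': "-p \<in> unit_disc" using p by simp
  show "(\<lambda>z. disc_shift p (\<phi> t (disc_shift (-p) z))) holomorphic_on unit_disc \<and>
      (\<lambda>z. disc_shift p (\<phi> t (disc_shift (-p) z))) ` unit_disc \<subseteq> unit_disc" if "0 \<le> t" for t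
  proof
    show "(\<lambda>z. disc_shift p (\<phi> t (disc_shift (-p) z))) ` unit_disc \<subseteq> unit_disc"
      by (intro image_subsetI disc_shift_in_disc in_disc p p' that)
    have "(disc_shift p \<circ> (\<phi> t \<circ> disc_shift (-p))) holomorphic_on unit_disc"
      using p that disc_shift_in_disc[OF p'] self_map[OF that]
      by (intro holomorphic_on_compose_gen[where t = unit_disc] Moebius_function_holomorphic holo) auto
    then show "(\<lambda>z. disc_shift p (\<phi> t (disc_shift (-p) z))) holomorphic_on unit_disc"
      by (simp add: o_def)
  qed
  show "disc_shift p (\<phi> 0 (disc_shift (-p) z)) = z" if "z \<in> unit_disc" for z
    using at_0[OF disc_shift_in_disc[OF p' that]] disc_shift_inverse(1)[OF p that] by simp
  show "((\<lambda>t. disc_shift p (\<phi> t (disc_shift (-p) z))) has_vector_derivative pullback p z) (at 0 within {0..})"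
    if "z \<in> unit_disc" for z
    using has_vector_derivative_shifted_orbit[OF p disc_shift_in_disc[OF p' that], of 0]
      at_0[OF disc_shift_in_disc[OF p' that]] disc_shift_inverse(1)[OF p that] by simp
qed

text \<open>Along a shifted orbit the squared modulus has derivative 2 Re(conj(w) W(w)). The sign k
  covers both directions of monotonicity, so that the rotation case can use both.\<close>

lemma norm_shifted_orbit_mono:
  assumes p: "p \<in> unit_disc" and z: "z \<in> unit_disc" and t: "t \<ge> 0" and k: "k = 1 \<or> k = -1"
    and sign: "\<And>w. w \<in> unit_disc \<Longrightarrow> k * Re (cnj w * pullback p w) \<le> 0"
  shows "k * (norm (disc_shift p (\<phi> t z)))\<^sup>2 \<le> k * (norm (disc_shift p z))\<^sup>2"
proof -
  define w where "w s = disc_shift p (\<phi> s z)" for s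
  have wd: "w s \<in> unit_disc" if "s \<ge> 0" for s
    unfolding w_def by (intro disc_shift_in_disc in_disc p z that)
  have dw: "(w has_vector_derivative pullback p (w s)) (at s within {0..})" if "s \<ge> 0" for s
    unfolding w_def by (rule has_vector_derivative_shifted_orbit[OF p z that])
  have cont: "continuous_on {0..t} w"
    unfolding continuous_on_eq_continuous_within
    by (intro ballI continuous_within_subset[OF has_vector_derivative_continuous[OF dw]]) auto
  have "- k * (w 0 \<bullet> w 0) \<le> - k * (w t \<bullet> w t)"
  proof (rule DERIV_nonneg_imp_increasing_open[OF t])
    show "continuous_on {0..t} (\<lambda>s. - k * (w s \<bullet> w s))"
      by (intro continuous_intros cont)
    fix s assume s: "0 < s" "s < t"
    have "at s within {0..} = at s"
      using s by (intro at_within_interior) simp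
    then have dw': "(w has_vector_derivative pullback p (w s)) (at s)"
      using dw[of s] s by simp
    define g where "g = pullback p (w s)"
    have eq: "w s \<bullet> g + g \<bullet> w s = 2 * Re (cnj (w s) * g)"
      by (simp add: inner_complex_def)
    have "((\<lambda>s. w s \<bullet> w s) has_real_derivative (w s \<bullet> g + g \<bullet> w s)) (at s)"
      using bounded_bilinear.has_vector_derivative[OF bounded_bilinear_inner dw' dw']
      by (simp add: has_real_derivative_iff_has_vector_derivative g_def)
    then have "((\<lambda>s. - k * (w s \<bullet> w s)) has_real_derivative - k * (2 * Re (cnj (w s) * g))) (at s)"
      unfolding eq by (rule DERIV_cmult)
    moreover have "0 \<le> - k * (2 * x)" if "k * x \<le> 0" for x
      using that k by auto
    then have "0 \<le> - k * (2 * Re (cnj (w s) * g))"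
      unfolding g_def using sign[OF wd] s by (meson less_imp_le)
    ultimately show "\<exists>D. ((\<lambda>s. - k * (w s \<bullet> w s)) has_real_derivative D) (at s) \<and> 0 \<le> D"
      by blast
  qed
  then show ?thesis
    unfolding w_def at_0[OF z] by (simp add: power2_norm_eq_inner)
qed

text \<open>At a zero of the generator W(0) = 0, and the infinitesimal Schwarz-Pick inequality
  becomes Re(conj(w) W(w)) <= 0: hyperbolic discs about p are forward invariant.\<close>

lemma norm_shifted_orbit_le:
  assumes p: "p \<in> unit_disc" and z: "z \<in> unit_disc" and t: "t \<ge> 0" and zero: "generator p = 0"
  shows "norm (disc_shift p (\<phi> t z)) \<le> norm (disc_shift p z)"
proof -
  have "pullback p 0 = 0" using pullback_0[OF p] zero by simp
  then have "1 * (norm (disc_shift p (\<phi> t z)))\<^sup>2 \<le> 1 * (norm (disc_shift p z))\<^sup>2"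
    using pullback_infinitesimal_Schwarz_Pick[OF p]
    by (intro norm_shifted_orbit_mono p z t) auto
  then show ?thesis by (simp add: power2_le_iff_abs_le)
qed

lemma norm_shifted_orbit_eq:
  assumes p: "p \<in> unit_disc" and z: "z \<in> unit_disc" and t: "t \<ge> 0"
    and orth: "\<And>w. w \<in> unit_disc \<Longrightarrow> Re (cnj w * pullback p w) = 0"
  shows "norm (disc_shift p (\<phi> t z)) = norm (disc_shift p z)"
proof -
  have "k * (norm (disc_shift p (\<phi> t z)))\<^sup>2 \<le> k * (norm (disc_shift p z))\<^sup>2" if "k = 1 \<or> k = -1" for k :: real
    by (rule norm_shifted_orbit_mono[OF p z t that]) (simp only: orth mult_zero_right order_refl)
  from this[of 1] this[of "-1"] show ?thesis by (simp add: power2_le_iff_abs_le)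
qed

text \<open>The Koenigs function of the semigroup (its exponential in the absence of fixed points)
  is a solution \<open>h\<close> of this equation.\<close>

definition linearizes :: "(complex \<Rightarrow> complex) \<Rightarrow> complex \<Rightarrow> bool" where
  "linearizes h c \<longleftrightarrow> h holomorphic_on unit_disc \<and> exp c \<noteq> 1 \<and>
     (\<forall>z\<in>unit_disc. deriv h z * generator z = c * h z)"

text \<open>The differential equation for h says that exp(-c s) h(phi_s(z)) has derivative zero in
  s.\<close>

lemma linearizes_orbit:
  assumes h: "linearizes h c" and z: "z \<in> unit_disc" and t: "t \<ge> 0"
  shows "h (\<phi> t z) = exp (c * of_real t) * h z"
proof -
  define u where "u s = exp (- c * of_real s) * h (\<phi> s z)" for s
  have "(u has_vector_derivative 0) (at s within {0..})" if s: "s \<in> {0..}" for s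
  proof -
    have ps: "\<phi> s z \<in> unit_disc" using in_disc z s by simp
    have dh: "(h has_field_derivative deriv h (\<phi> s z)) (at (\<phi> s z))"
      using h ps unfolding linearizes_def by (intro holomorphic_derivI[OF _ open_ball]) auto
    have "((h \<circ> (\<lambda>s. \<phi> s z)) has_vector_derivative generator (\<phi> s z) * deriv h (\<phi> s z)) (at s within {0..})"
      using s by (intro field_vector_diff_chain_within has_vector_derivative_orbit z
          has_field_derivative_at_within[OF dh]) auto
    moreover have "generator (\<phi> s z) * deriv h (\<phi> s z) = c * h (\<phi> s z)"
      using h ps unfolding linearizes_def by (simp add: mult.commute)
    ultimately have 1: "((\<lambda>s. h (\<phi> s z)) has_vector_derivative c * h (\<phi> s z)) (at s within {0..})"
      by (simp add: o_def)
    have "((exp \<circ> (\<lambda>s. - c * of_real s)) has_vector_derivative (- c) * exp (- c * of_real s)) (at s within {0..})"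
      by (intro field_vector_diff_chain_within) (auto intro!: derivative_eq_intros DERIV_exp)
    then have 2: "((\<lambda>s. exp (- c * of_real s)) has_vector_derivative (- c) * exp (- c * of_real s)) (at s within {0..})"
      by (simp add: o_def)
    show ?thesis
      using has_vector_derivative_mult[OF 2 1] unfolding u_def by (simp add: algebra_simps)
  qed
  then have "u t = u 0"
    using has_vector_derivative_zero_constant[of "{0..}" u] t by (metis atLeast_iff convex_real_interval(1) order_refl)
  then have "exp (c * of_real t) * u t = exp (c * of_real t) * h z"
    by (simp add: u_def at_0[OF z])
  moreover have "exp (c * of_real t) * u t = h (\<phi> t z)"
    unfolding u_def mult.assoc[symmetric] exp_add[symmetric] by simp
  ultimately show ?thesis by simp
qed

text \<open>One C serves all p. In the coordinate centred at p, h is a constant times exp L for a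
  primitive L of c/W, so exp(L(a) - L(0)) = exp c with a the image of phi_1(p). Since exp c <> 1,
  the increment of L has a positive lower bound, while the lower bound on |W| makes it small when
  |W(0)| is large.\<close>

lemma generator_bound:
  assumes h: "linearizes h c" and r: "0 \<le> r" "r < R" and R: "1/2 < R" "R < 1"
  obtains C where
    "\<And>p. \<lbrakk>p \<in> unit_disc; norm (disc_shift p (\<phi> 1 p)) \<le> r; h p \<noteq> 0;
      \<And>z. norm z < R \<Longrightarrow> generator (disc_shift (-p) z) \<noteq> 0\<rbrakk> \<Longrightarrow> norm (generator p) \<le> C"
proof -
  obtain k where k: "k > 0"
    "\<And>W z. \<lbrakk>W holomorphic_on unit_disc;
      \<And>z. z \<in> unit_disc \<Longrightarrow> Re (cnj z * (W z - W 0 + cnj (W 0) * z\<^sup>2)) \<le> 0;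
      \<And>z. norm z < R \<Longrightarrow> W z \<noteq> 0; norm z \<le> r\<rbrakk> \<Longrightarrow> k * norm (W 0) \<le> norm (W z)"
    using generator_lower_bound[OF r R] by metis
  \<comment> \<open>This yields a radius \<eta> around 0 in which no exponent x satisfies exp x =
    exp c.\<close>
  have "isCont exp (0::complex)" by simp
  moreover have "norm (exp c - 1) > 0" using h by (simp add: linearizes_def)
  ultimately have "\<exists>\<eta>>0. \<forall>x::complex. norm x < \<eta> \<longrightarrow> norm (exp x - 1) < norm (exp c - 1)"
    unfolding continuous_at_eps_delta by (simp add: dist_norm)
  then obtain \<eta> where \<eta>: "\<eta> > 0" "\<And>x::complex. norm x < \<eta> \<Longrightarrow> norm (exp x - 1) < norm (exp c - 1)"
    by blast
  show ?thesis
  proof (rule that)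
    fix p assume p: "p \<in> unit_disc" and step: "norm (disc_shift p (\<phi> 1 p)) \<le> r" and hp: "h p \<noteq> 0"
      and nz: "\<And>z. norm z < R \<Longrightarrow> generator (disc_shift (-p) z) \<noteq> 0"
    define W where "W = pullback p"
    define a where "a = disc_shift p (\<phi> 1 p)"
    have R_sub: "ball 0 R \<subseteq> unit_disc" using R by auto
    have holW: "W holomorphic_on unit_disc"
      unfolding W_def by (rule holomorphic_pullback[OF p])
    have Wnz: "W z \<noteq> 0" if "norm z < R" for z
      using pullback_eq_0_iff[OF p, of z] nz[OF that] that R by (simp add: W_def)
    have lower: "k * norm (W 0) \<le> norm (W z)" if "norm z \<le> r" for z
      using pullback_infinitesimal_Schwarz_Pick[OF p] by (intro k(2) holW Wnz that) (auto simp: W_def)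
    have "(\<lambda>z. c / W z) holomorphic_on ball 0 R"
      using Wnz by (intro holomorphic_intros holomorphic_on_subset[OF holW R_sub]) auto
    then obtain L where L: "\<And>z. z \<in> ball 0 R \<Longrightarrow> (L has_field_derivative c / W z) (at z within ball 0 R)"
      by (rule holomorphic_convex_primitive'[OF convex_ball open_ball]) blast
    have W0: "norm (W 0) > 0" using Wnz[of 0] R by simp
    have bound: "norm (L a - L 0) \<le> norm c / (k * norm (W 0)) * norm (a - 0)"
    proof (rule field_differentiable_bound[OF convex_cball[of 0 r]])
      fix z :: complex assume z: "z \<in> cball 0 r"
      show "(L has_field_derivative c / W z) (at z within cball 0 r)"
        by (rule has_field_derivative_subset[OF L]) (use z r in auto)
      show "norm (c / W z) \<le> norm c / (k * norm (W 0))"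
        unfolding norm_divide by (intro frac_le mult_pos_pos k(1) W0 lower) (use z in auto)
    qed (use step r in \<open>auto simp: a_def\<close>)
    \<comment> \<open>Constancy of this product replaces the choice of a logarithm of h.\<close>
    define u where "u z = h (disc_shift (-p) z) * exp (- L z)" for z
    have "(u has_field_derivative 0) (at z within ball 0 R)" if z: "z \<in> ball 0 R" for z
    proof -
      define m where "m = disc_shift (-p) z"
      define m' where "m' = of_real (1 - (norm p)\<^sup>2) / (1 + cnj p * z)\<^sup>2"
      have zd: "z \<in> unit_disc" using z R_sub by auto
      have md: "m \<in> unit_disc" unfolding m_def using p zd disc_shift_in_disc[of "-p"] by simp
      have dm: "(disc_shift (-p) has_field_derivative m') (at z)"
        using has_field_derivative_disc_shift[of "-p" z] p zd by (simp add: m'_def)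
      have dh: "(h has_field_derivative deriv h m) (at m)"
        using h md unfolding linearizes_def by (intro holomorphic_derivI[OF _ open_ball]) auto
      have "((\<lambda>z. h (disc_shift (-p) z)) has_field_derivative deriv h m * m') (at z within ball 0 R)"
        unfolding m_def
        by (rule DERIV_chain2[OF dh[unfolded m_def] has_field_derivative_at_within[OF dm]])
      moreover have "((\<lambda>z. exp (- L z)) has_field_derivative exp (- L z) * (- (c / W z))) (at z within ball 0 R)"
        by (intro derivative_intros L z)
      ultimately have "(u has_field_derivative
          (h m * (exp (- L z) * (- (c / W z))) + deriv h m * m' * exp (- L z))) (at z within ball 0 R)"
        unfolding u_def m_def by (rule DERIV_mult')
      moreover have "deriv h m * m' * W z = c * h m"
      proof -
        have "m' * W z = generator m * (of_real (1 - (norm p)\<^sup>2) / (1 - cnj p * m)\<^sup>2 * m')"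
          unfolding W_def pullback_def m_def by (simp only: mult_ac)
        also have "\<dots> = generator m"
          unfolding m_def m'_def disc_shift_deriv_inverse[OF p zd] by simp
        finally show ?thesis
          using h md unfolding linearizes_def by (simp add: mult.assoc)
      qed
      then have "h m * (exp (- L z) * (- (c / W z))) + deriv h m * m' * exp (- L z) = 0"
        using Wnz[of z] z by (simp add: field_simps)
      ultimately show ?thesis by simp
    qed
    then have "\<exists>d. \<forall>z\<in>ball 0 R. u z = d"
      by (intro has_field_derivative_zero_constant convex_ball)
    then have "u a = u 0"
      using step r R unfolding a_def by (metis centre_in_ball dist_0_norm le_less_trans mem_ball)
    moreover have "disc_shift (-p) a = \<phi> 1 p"
      unfolding a_def by (intro disc_shift_inverse(2) p in_disc) simp
    moreover have "disc_shift (-p) 0 = p" by (simp add: Moebius_function_of_zero)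
    moreover have "h (\<phi> 1 p) = exp c * h p"
      using linearizes_orbit[OF h p, of 1] by simp
    ultimately have "exp c * exp (- L a) = exp (- L 0)"
      using hp by (simp add: u_def)
    then have "exp c = exp (L a - L 0)"
      by (simp add: exp_diff exp_minus field_simps)
    then have "\<eta> \<le> norm (L a - L 0)"
      using \<eta>(2)[of "L a - L 0"] by fastforce
    also have "\<dots> \<le> norm c / (k * norm (W 0)) * 1"
      using step r R k(1) W0 unfolding a_def[symmetric]
      by (intro order.trans[OF bound] mult_left_mono) auto
    finally have "norm (W 0) \<le> norm c / (k * \<eta>)"
      using \<eta>(1) k(1) W0 by (simp add: field_simps)
    moreover have "norm (generator p) \<le> norm (W 0)"
    proof -
      have p1: "0 < 1 - (norm p)\<^sup>2" using p by (simp add: power_less_one_iff abs_square_less_1)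
      then have "norm (generator p) = norm (W 0) * (1 - (norm p)\<^sup>2)"
        unfolding W_def pullback_0[OF p] norm_divide norm_of_real by simp
      also have "\<dots> \<le> norm (W 0) * 1" by (intro mult_left_mono) auto
      finally show ?thesis by simp
    qed
    ultimately show "norm (generator p) \<le> norm c / (k * \<eta>)" by simp
  qed
qed

text \<open>A primitive F of 1/G grows by t along the flow for time t. Its exponential turns
  translation into multiplication and has no zeros.\<close>

lemma linearizes_nonelliptic:
  assumes nz: "\<And>z. z \<in> unit_disc \<Longrightarrow> generator z \<noteq> 0"
  obtains h where "linearizes h 1" "\<And>z. z \<in> unit_disc \<Longrightarrow> h z \<noteq> 0"
proof -
  have "(\<lambda>z. 1 / generator z) holomorphic_on unit_disc"
    using nz by (intro holomorphic_intros holomorphic_generator) auto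
  then obtain F where F: "\<And>z. z \<in> unit_disc \<Longrightarrow> (F has_field_derivative 1 / generator z) (at z within unit_disc)"
    by (rule holomorphic_convex_primitive'[OF convex_ball open_ball]) blast
  have dF: "((\<lambda>z. exp (F z)) has_field_derivative exp (F z) * (1 / generator z)) (at z)" if "z \<in> unit_disc" for z
    using F[OF that] unfolding at_within_open[OF that open_ball] by (intro derivative_intros)
  have "(\<lambda>z. exp (F z)) holomorphic_on unit_disc"
    unfolding holomorphic_on_open[OF open_ball] using dF by blast
  moreover have "deriv (\<lambda>z. exp (F z)) z * generator z = 1 * exp (F z)" if "z \<in> unit_disc" for z
    using DERIV_imp_deriv[OF dF[OF that]] nz[OF that] by simp
  moreover have "exp 1 \<noteq> (1::complex)"
    by (metis exp_gt_one less_irrefl norm_exp_eq_Re norm_one one_complex.simps(1) zero_less_one)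
  ultimately show ?thesis
    by (intro that[of "\<lambda>z. exp (F z)"]) (auto simp: linearizes_def)
qed

text \<open>In the coordinate centred at p the equation reads h0'/h0 = q(0)/(z q(z)) = 1/z +
  g(z)/q(z), where q(0) - q(z) = z g(z). The second term is holomorphic, so h0 is z times the
  exponential of a primitive. The multiplier differs from 1 because |exp(-q(0))| < 1.\<close>

lemma linearizes_elliptic:
  assumes p: "p \<in> unit_disc"
    and holq: "q holomorphic_on unit_disc" and pos: "\<And>z. z \<in> unit_disc \<Longrightarrow> 0 < Re (q z)"
    and pull: "\<And>z. z \<in> unit_disc \<Longrightarrow> pullback p z = - z * q z"
  obtains h where "linearizes h (- q 0)" "\<And>z. z \<in> unit_disc \<Longrightarrow> z \<noteq> p \<Longrightarrow> h z \<noteq> 0"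
proof -
  have qnz: "q z \<noteq> 0" if "z \<in> unit_disc" for z using pos[OF that] by auto
  have "(\<lambda>z. q 0 - q z) holomorphic_on ball 0 1"
    by (intro holomorphic_intros holq)
  then obtain g where g: "g holomorphic_on ball 0 1" "\<And>z. norm z < 1 \<Longrightarrow> q 0 - q z = z * g z"
    by (rule Schwarz3) auto
  have "(\<lambda>z. g z / q z) holomorphic_on unit_disc"
    using qnz by (intro holomorphic_intros holq g(1)) auto
  then obtain P where P: "\<And>z. z \<in> unit_disc \<Longrightarrow> (P has_field_derivative g z / q z) (at z within unit_disc)"
    by (rule holomorphic_convex_primitive'[OF convex_ball open_ball]) blast
  define h0 where "h0 z = z * exp (P z)" for z
  have dh0: "(h0 has_field_derivative exp (P z) * (q 0 / q z)) (at z)" if "z \<in> unit_disc" for z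
  proof -
    have dP: "(P has_field_derivative g z / q z) (at z)"
      using P[OF that] unfolding at_within_open[OF that open_ball] .
    have "(h0 has_field_derivative z * (exp (P z) * (g z / q z)) + 1 * exp (P z)) (at z)"
      unfolding h0_def by (intro DERIV_mult' DERIV_ident DERIV_chain2[OF DERIV_exp] dP)
    moreover have "z * (exp (P z) * (g z / q z)) + 1 * exp (P z) = exp (P z) * ((z * g z + q z) / q z)"
      using qnz[OF that] by (simp add: field_simps)
    moreover have "z * g z + q z = q 0" using g(2)[of z] that by (simp flip: g(2))
    ultimately show ?thesis by simp
  qed
  define D where "D z = of_real (1 - (norm p)\<^sup>2) / (1 - cnj p * z)\<^sup>2" for z
  define h where "h z = h0 (disc_shift p z)" for z
  have dh: "(h has_field_derivative exp (P (disc_shift p z)) * (q 0 / q (disc_shift p z)) * D z) (at z)"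
    if "z \<in> unit_disc" for z
    unfolding h_def[abs_def] D_def
    by (rule DERIV_chain2[OF dh0[OF disc_shift_in_disc[OF p that]] has_field_derivative_disc_shift[OF p that]])
  have "deriv h z * generator z = - q 0 * h z" if z: "z \<in> unit_disc" for z
  proof -
    have "generator z * D z = - disc_shift p z * q (disc_shift p z)"
      using pullback_disc_shift[OF p z] pull[OF disc_shift_in_disc[OF p z]] by (simp add: D_def)
    moreover have "deriv h z * generator z
        = exp (P (disc_shift p z)) * (q 0 / q (disc_shift p z)) * (generator z * D z)"
      unfolding DERIV_imp_deriv[OF dh[OF z]] by (simp only: mult_ac)
    ultimately show ?thesis
      using qnz[OF disc_shift_in_disc[OF p z]] by (simp add: h_def h0_def field_simps)
  qed
  moreover have "h holomorphic_on unit_disc"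
    unfolding holomorphic_on_open[OF open_ball] using dh by blast
  moreover have "exp (- q 0) \<noteq> 1"
  proof
    assume "exp (- q 0) = 1"
    then have "exp (Re (- q 0)) = 1" by (metis norm_exp_eq_Re norm_one)
    then show False using pos[of 0] by simp
  qed
  moreover have "h z \<noteq> 0" if "z \<in> unit_disc" "z \<noteq> p" for z
  proof -
    have "disc_shift p z \<noteq> 0"
      using that one_minus_cnj_mult_nonzero[of p z] p by (simp add: Moebius_function_simple)
    then show ?thesis by (simp add: h_def h0_def)
  qed
  ultimately show ?thesis
    by (intro that[of h]) (auto simp: linearizes_def)
qed

end

subsection \<open>Backward orbits\<close>

text \<open>The right-hand side is tanh M.\<close>

lemma hyperbolic_dist_le_imp:
  assumes z: "z \<in> unit_disc" and w: "w \<in> unit_disc" and le: "hyperbolic_dist z w \<le> M"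
  shows "norm (disc_shift z w) \<le> (exp (2 * M) - 1) / (exp (2 * M) + 1)"
proof -
  define A where "A = norm (1 - cnj z * w)"
  define B where "B = norm (z - w)"
  have eq: "norm (disc_shift z w) = B / A"
    by (simp add: A_def B_def Moebius_function_simple norm_divide norm_minus_commute)
  have A: "A > 0" using one_minus_cnj_mult_nonzero[of z w] z w by (simp add: A_def)
  have "B / A < 1" using Moebius_function_norm_lt_1[of z w 0] z w unfolding eq[symmetric] by simp
  then have AB: "B < A" using A by simp
  have B: "B \<ge> 0" by (simp add: B_def)
  have "ln ((A + B) / (A - B)) \<le> 2 * M"
    using le by (simp add: hyperbolic_dist_def A_def B_def)
  then have "(A + B) / (A - B) \<le> exp (2 * M)"
    using A AB B by (metis add_pos_nonneg diff_gt_0_iff_gt divide_pos_pos exp_le_cancel_iff exp_ln)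
  then have "A + B \<le> exp (2 * M) * (A - B)"
    using AB by (simp add: pos_divide_le_eq)
  then have "B * (exp (2 * M) + 1) \<le> (exp (2 * M) - 1) * A"
    by (simp add: algebra_simps)
  moreover have "exp (2 * M) + 1 > 0" by (simp add: add_pos_pos)
  ultimately show ?thesis
    unfolding eq using A by (simp add: pos_divide_le_eq pos_le_divide_eq mult.commute)
qed

text \<open>Seen from the later endpoint t, u -> gamma(t - u) is a forward orbit, so the mean value
  inequality applies without differentiating gamma itself.\<close>

lemma (in disc_semigroup) lipschitz_of_generator_bound:
  assumes \<gamma>: "\<And>t. t \<ge> 0 \<Longrightarrow> \<gamma> t \<in> unit_disc" "\<And>s t. s \<ge> 0 \<Longrightarrow> t \<ge> 0 \<Longrightarrow> \<phi> s (\<gamma> (t + s)) = \<gamma> t"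
    and C: "\<And>t. t \<ge> 0 \<Longrightarrow> norm (generator (\<gamma> t)) \<le> C" "C \<ge> 0"
  shows "C-lipschitz_on {0..} \<gamma>"
proof -
  have *: "norm (\<gamma> s - \<gamma> t) \<le> C * (t - s)" if st: "0 \<le> s" "s < t" for s t
  proof -
    define w where "w u = \<phi> u (\<gamma> t)" for u
    have w: "w u = \<gamma> (t - u)" if "0 \<le> u" "u \<le> t" for u
      using \<gamma>(2)[of u "t - u"] that by (simp add: w_def)
    have dw: "(w has_vector_derivative generator (w u)) (at u within {0..})" if "u \<ge> 0" for u
      unfolding w_def using has_vector_derivative_orbit[OF \<gamma>(1) that] st by simp
    have "norm (w (t - s) - w 0) \<le> C * (t - s) - C * 0"
    proof (rule differentiable_bound_general[where f' = "\<lambda>u. generator (w u)" and \<phi>' = "\<lambda>_. C" and \<phi> = "\<lambda>u. C * u"])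
      show "continuous_on {0..t - s} w"
        unfolding w_def
        by (rule continuous_on_subset[OF continuous_orbit[OF \<gamma>(1)]]) (use st in auto)
      fix u assume u: "0 < u" "u < t - s"
      have "at u within {0..} = at u"
        using u by (intro at_within_interior) simp
      then show "(w has_vector_derivative generator (w u)) (at u)"
        using dw[of u] u by simp
      show "((\<lambda>u. C * u) has_vector_derivative C) (at u)"
        by (auto intro!: derivative_eq_intros)
      show "norm (generator (w u)) \<le> C"
        using w[of u] C(1)[of "t - u"] u st by simp
    qed (use st in \<open>auto intro!: continuous_intros\<close>)
    then show ?thesis
      using w[of "t - s"] w[of 0] st by simp
  qed
  show ?thesis
  proof (rule lipschitz_onI[OF _ C(2)])
    fix s t :: real assume "s \<in> {0..}" "t \<in> {0..}"
    then show "dist (\<gamma> s) (\<gamma> t) \<le> C * dist s t"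
      using *[of s t] *[of t s] by (cases s t rule: linorder_cases) (auto simp: dist_norm norm_minus_commute)
  qed
qed

lemma (in disc_semigroup) generator_bound_shifted_disc:
  assumes p: "p \<in> unit_disc" and r: "r < 1"
  obtains C where "\<And>z. \<lbrakk>z \<in> unit_disc; norm (disc_shift p z) \<le> r\<rbrakk> \<Longrightarrow> norm (generator z) \<le> C"
proof -
  define K where "K = disc_shift (-p) ` cball 0 r"
  have "continuous_on (cball 0 r) (disc_shift (-p))"
    using p r by (intro continuous_on_subset[OF holomorphic_on_imp_continuous_on[OF Moebius_function_holomorphic[of "-p"]]]) auto
  then have "compact K" unfolding K_def by (intro compact_continuous_image) auto
  moreover have "K \<subseteq> unit_disc"
    unfolding K_def using disc_shift_in_disc[of "-p"] p r by (intro image_subsetI) auto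
  ultimately have "bounded (generator ` K)"
    by (intro compact_imp_bounded compact_continuous_image continuous_on_subset[OF
        holomorphic_on_imp_continuous_on[OF holomorphic_generator]])
  then obtain C where C: "\<forall>v\<in>generator ` K. norm v \<le> C"
    unfolding bounded_iff by blast
  show ?thesis
  proof (rule that)
    fix z assume "z \<in> unit_disc" "norm (disc_shift p z) \<le> r"
    then have "z \<in> K"
      unfolding K_def using disc_shift_inverse(2)[OF p, of z] by (intro image_eqI[of _ _ "disc_shift p z"]) auto
    then show "norm (generator z) \<le> C" using C by blast
  qed
qed

text \<open>The function exp(-q) has modulus at most 1 and attains 1 at any zero of Re q, so the
  maximum principle makes it constant. This separates rotations about the fixed point from
  attraction towards it.\<close>

lemma Re_zero_or_pos:
  assumes holq: "q holomorphic_on unit_disc" and nonneg: "\<And>z. z \<in> unit_disc \<Longrightarrow> 0 \<le> Re (q z)"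
  shows "(\<forall>z\<in>unit_disc. Re (q z) = 0) \<or> (\<forall>z\<in>unit_disc. 0 < Re (q z))"
proof (rule disjCI)
  assume "\<not> (\<forall>z\<in>unit_disc. 0 < Re (q z))"
  then obtain w where w: "w \<in> unit_disc" "Re (q w) = 0"
    using nonneg by force
  have "(\<lambda>z. exp (- q z)) constant_on unit_disc"
  proof (rule maximum_modulus_principle[where U = unit_disc and \<xi> = w])
    show "(\<lambda>z. exp (- q z)) holomorphic_on unit_disc"
      by (intro holomorphic_intros holq)
    show "norm (exp (- q z)) \<le> norm (exp (- q w))" if "z \<in> unit_disc" for z
      using nonneg[OF that] w by simp
  qed (use w in auto)
  then obtain c where c: "\<And>z. z \<in> unit_disc \<Longrightarrow> exp (- q z) = c"
    unfolding constant_on_def by blast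
  show "\<forall>z\<in>unit_disc. Re (q z) = 0"
  proof
    fix z assume "z \<in> unit_disc"
    then have "norm (exp (- q z)) = norm (exp (- q w))" using c w(1) by simp
    then show "Re (q z) = 0" using w(2) by simp
  qed
qed

lemma (in disc_semigroup) generator_bound_backward_orbit:
  assumes \<gamma>: "\<And>t. t \<ge> 0 \<Longrightarrow> \<gamma> t \<in> unit_disc" "\<And>s t. s \<ge> 0 \<Longrightarrow> t \<ge> 0 \<Longrightarrow> \<phi> s (\<gamma> (t + s)) = \<gamma> t"
    and step: "\<And>t. t \<ge> T \<Longrightarrow> norm (disc_shift (\<gamma> t) (\<gamma> (t + 1))) \<le> r" and T: "T \<ge> 0" and r: "0 \<le> r" "r < 1"
  obtains S C where "S \<ge> 0" "\<And>t. t \<ge> S \<Longrightarrow> norm (generator (\<gamma> t)) \<le> C"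
proof -
  \<comment> \<open>The midpoint between max r (1/2) and 1 leaves room on both sides.\<close>
  define R where "R = (1 + max r (1/2)) / 2"
  have R: "r < R" "1/2 < R" "R < 1" using r by (auto simp: R_def)
  \<comment> \<open>Flowing forward by 1 from gamma(t) leads to gamma(t - 1), hence the shift of the
    threshold to T + 1.\<close>
  have step': "norm (disc_shift p (\<phi> 1 p)) \<le> r" if "p = \<gamma> t" "t \<ge> T + 1" for p t
  proof -
    have "\<phi> 1 p = \<gamma> (t - 1)" using \<gamma>(2)[of 1 "t - 1"] that T by simp
    then show ?thesis
      using step[of "t - 1"] that norm_disc_shift_commute[of "\<gamma> t" "\<gamma> (t - 1)"] by simp
  qed
  show ?thesis
  proof (cases "\<exists>p\<in>unit_disc. generator p = 0")
    case False
    then obtain h where h: "linearizes h 1" "\<And>z. z \<in> unit_disc \<Longrightarrow> h z \<noteq> 0"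
      using linearizes_nonelliptic by blast
    obtain C where C: "\<And>p. \<lbrakk>p \<in> unit_disc; norm (disc_shift p (\<phi> 1 p)) \<le> r; h p \<noteq> 0;
        \<And>z. norm z < R \<Longrightarrow> generator (disc_shift (-p) z) \<noteq> 0\<rbrakk> \<Longrightarrow> norm (generator p) \<le> C"
      using generator_bound[OF h(1) r(1) R] by metis
    have "norm (generator (\<gamma> t)) \<le> C" if t: "t \<ge> T + 1" for t
    proof (rule C)
      show \<gamma>t: "\<gamma> t \<in> unit_disc" using \<gamma>(1) t T by simp
      show "norm (disc_shift (\<gamma> t) (\<phi> 1 (\<gamma> t))) \<le> r" by (rule step'[OF refl t])
      show "h (\<gamma> t) \<noteq> 0" by (rule h(2)[OF \<gamma>t])
      show "generator (disc_shift (- \<gamma> t) z) \<noteq> 0" if "norm z < R" for z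
        using False disc_shift_in_disc[of "- \<gamma> t" z] \<gamma>t that R by auto
    qed
    then show ?thesis using that[of "T + 1" C] T by simp
  next
    case True
    then obtain p where p: "p \<in> unit_disc" "generator p = 0" by blast
    have W0: "pullback p 0 = 0" using pullback_0[OF p(1)] p(2) by simp
    obtain q where q: "q holomorphic_on unit_disc" "\<And>z. z \<in> unit_disc \<Longrightarrow> 0 \<le> Re (q z)"
      "\<And>z. z \<in> unit_disc \<Longrightarrow> pullback p z = - z * q z"
      using generator_decomposition[OF holomorphic_pullback[OF p(1)] pullback_infinitesimal_Schwarz_Pick[OF p(1)]]
      by (auto simp: W0)
    consider (rotation) "\<forall>z\<in>unit_disc. Re (q z) = 0" | (attracting) "\<forall>z\<in>unit_disc. 0 < Re (q z)"
      using Re_zero_or_pos[OF q(1,2)] by blast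
    then show ?thesis
    proof cases
      case rotation
      \<comment> \<open>The field is orthogonal to the radius, so the whole backward orbit lies on
        the hyperbolic circle about p through gamma(0).\<close>
      have orth: "Re (cnj w * pullback p w) = 0" if "w \<in> unit_disc" for w
      proof -
        have "cnj w * pullback p w = - (of_real ((norm w)\<^sup>2) * q w)"
          unfolding q(3)[OF that] complex_norm_square by (simp add: mult_ac)
        then show ?thesis using rotation that by simp
      qed
      obtain C where C: "\<And>z. \<lbrakk>z \<in> unit_disc; norm (disc_shift p z) \<le> norm (disc_shift p (\<gamma> 0))\<rbrakk> \<Longrightarrow> norm (generator z) \<le> C"
        using generator_bound_shifted_disc[OF p(1), of "norm (disc_shift p (\<gamma> 0))"]
          disc_shift_in_disc[OF p(1) \<gamma>(1)[of 0]] by auto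
      have "norm (generator (\<gamma> t)) \<le> C" if "t \<ge> 0" for t
      proof (rule C[OF \<gamma>(1)[OF that]])
        have "norm (disc_shift p (\<phi> t (\<gamma> t))) = norm (disc_shift p (\<gamma> t))"
          by (rule norm_shifted_orbit_eq[OF p(1) \<gamma>(1)[OF that] that orth])
        then show "norm (disc_shift p (\<gamma> t)) \<le> norm (disc_shift p (\<gamma> 0))"
          using \<gamma>(2)[OF that, of 0] by simp
      qed
      then show ?thesis using that[of 0 C] by simp
    next
      case attracting
      obtain h where h: "linearizes h (- q 0)" "\<And>z. z \<in> unit_disc \<Longrightarrow> z \<noteq> p \<Longrightarrow> h z \<noteq> 0"
        using linearizes_elliptic[OF p(1) q(1) _ q(3)] attracting by blast
      obtain C where C: "\<And>p. \<lbrakk>p \<in> unit_disc; norm (disc_shift p (\<phi> 1 p)) \<le> r; h p \<noteq> 0;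
          \<And>z. norm z < R \<Longrightarrow> generator (disc_shift (-p) z) \<noteq> 0\<rbrakk> \<Longrightarrow> norm (generator p) \<le> C"
        using generator_bound[OF h(1) r(1) R] by metis
      have zeros: "z = p" if z: "z \<in> unit_disc" "generator z = 0" for z
      proof -
        have "disc_shift p z * q (disc_shift p z) = 0"
          using pullback_disc_shift[OF p(1) z(1)] q(3)[OF disc_shift_in_disc[OF p(1) z(1)]] z(2) by simp
        moreover have "q (disc_shift p z) \<noteq> 0"
          using attracting disc_shift_in_disc[OF p(1) z(1)] by force
        ultimately have "disc_shift p z = 0" by simp
        then show ?thesis
          using one_minus_cnj_mult_nonzero[of p z] p(1) z(1) by (simp add: Moebius_function_simple)
      qed
      show ?thesis
      proof (cases "\<exists>s\<ge>0. R \<le> norm (disc_shift p (\<gamma> s))")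
        case True
        then obtain s where s: "s \<ge> 0" "R \<le> norm (disc_shift p (\<gamma> s))" by blast
        have "norm (generator (\<gamma> t)) \<le> C" if t: "t \<ge> max s (T + 1)" for t
        proof (rule C)
          show \<gamma>t: "\<gamma> t \<in> unit_disc" using \<gamma>(1) t T by simp
          show "norm (disc_shift (\<gamma> t) (\<phi> 1 (\<gamma> t))) \<le> r" using step'[OF refl] t by simp
          have "\<phi> (t - s) (\<gamma> t) = \<gamma> s" using \<gamma>(2)[of "t - s" s] t s by simp
          \<comment> \<open>The forward flow does not increase the distance to p, so once the
            backward orbit has left the disc of radius R it stays outside. The disc of radius R
            about gamma(t) then misses p, the only zero.\<close>
          then have far: "R \<le> norm (disc_shift p (\<gamma> t))"
            using norm_shifted_orbit_le[OF p(1) \<gamma>t _ p(2), of "t - s"] t s by simp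
          then have "\<gamma> t \<noteq> p" using R by (auto simp: Moebius_function_eq_zero)
          then show "h (\<gamma> t) \<noteq> 0" by (rule h(2)[OF \<gamma>t])
          show "generator (disc_shift (- \<gamma> t) z) \<noteq> 0" if z: "norm z < R" for z
          proof
            have zd: "z \<in> unit_disc" using z R by simp
            assume "generator (disc_shift (- \<gamma> t) z) = 0"
            then have "disc_shift (- \<gamma> t) z = p"
              using disc_shift_in_disc[of "- \<gamma> t" z] \<gamma>t zd by (intro zeros) auto
            then have "z = disc_shift (\<gamma> t) p"
              using disc_shift_inverse(1)[OF \<gamma>t zd] by simp
            then show False
              using far z norm_disc_shift_commute[of "\<gamma> t" p] by simp
          qed
        qed
        then show ?thesis using that[of "max s (T + 1)" C] s by simp
      next
        case False
        obtain C where C: "\<And>z. \<lbrakk>z \<in> unit_disc; norm (disc_shift p z) \<le> R\<rbrakk> \<Longrightarrow> norm (generator z) \<le> C"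
          using generator_bound_shifted_disc[OF p(1) R(3)] by blast
        have "norm (generator (\<gamma> t)) \<le> C" if "t \<ge> 0" for t
          using False that by (intro C \<gamma>(1)) auto
        then show ?thesis using that[of 0 C] by simp
      qed
    qed
  qed
qed

lemma backward_lifetime_infinite:
  assumes "backward_lifetime \<phi> z = \<infinity>" "t \<ge> 0"
  shows "z \<in> \<phi> t ` unit_disc"
proof -
  have "ereal t < Sup {ereal T | T. 0 < T \<and> (\<forall>t\<in>{0..<T}. z \<in> \<phi> t ` unit_disc)}"
    using assms(1) by (simp add: backward_lifetime_def)
  then obtain T where "t < T" "\<forall>t\<in>{0..<T}. z \<in> \<phi> t ` unit_disc"
    unfolding less_Sup_iff by auto
  then show ?thesis using assms(2) by auto
qed

theorem corollary1p4:
  fixes \<phi> :: "real \<Rightarrow> complex \<Rightarrow> complex" and z :: complex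
  assumes "holomorphic_semigroup \<phi>"
    and "z \<in> unit_disc"
    and "regular_backward_orbit \<phi> z"
  shows "\<exists>C>0. C-lipschitz_on (backward_domain \<phi> z) (backward_orbit \<phi> z)"
proof -
  interpret disc_semigroup \<phi> by unfold_locales (rule assms(1))
  define \<gamma> where "\<gamma> = backward_orbit \<phi> z"
  have life: "backward_lifetime \<phi> z = \<infinity>"
    and lim: "Limsup at_top (\<lambda>t. ereal (hyperbolic_dist (\<gamma> t) (\<gamma> (t + 1)))) < \<infinity>"
    using assms(3) unfolding regular_backward_orbit_def \<gamma>_def by auto
  have dom: "backward_domain \<phi> z = {0..}"
    by (auto simp: backward_domain_def life)
  have \<gamma>: "\<gamma> t \<in> unit_disc" "\<phi> t (\<gamma> t) = z" if "t \<ge> 0" for t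
    using backward_lifetime_infinite[OF life that] unfolding \<gamma>_def backward_orbit_def
    by (rule inv_into_into, rule f_inv_into_f)
  \<comment> \<open>Both sides are preimages of z under the injective map
    \<open>\<phi> t\<close>.\<close>
  have descend: "\<phi> s (\<gamma> (t + s)) = \<gamma> t" if "s \<ge> 0" "t \<ge> 0" for s t
  proof (rule inj_onD[OF inj_on_semigroup[OF that(2)]])
    show "\<phi> t (\<phi> s (\<gamma> (t + s))) = \<phi> t (\<gamma> t)"
      using add[OF that(2,1) \<gamma>(1)[of "t + s"]] \<gamma>(2)[of "t + s"] \<gamma>(2)[OF that(2)] that by simp
    show "\<phi> s (\<gamma> (t + s)) \<in> unit_disc" using that by (intro in_disc \<gamma>) auto
    show "\<gamma> t \<in> unit_disc" using that by (intro \<gamma>)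
  qed
  obtain M where "Limsup at_top (\<lambda>t. ereal (hyperbolic_dist (\<gamma> t) (\<gamma> (t + 1)))) < ereal M"
    using lim less_PInf_Ex_of_nat ereal_dense2 by blast
  then have "\<forall>\<^sub>F t in at_top. ereal (hyperbolic_dist (\<gamma> t) (\<gamma> (t + 1))) < ereal M"
    by (rule Limsup_lessD)
  then obtain T0 where T0: "\<And>t. t \<ge> T0 \<Longrightarrow> hyperbolic_dist (\<gamma> t) (\<gamma> (t + 1)) < M"
    unfolding eventually_at_top_linorder by auto
  define T where "T = max 0 T0"
  \<comment> \<open>The maximum with 0 makes r nonnegative without a discussion of the sign of
    M.\<close>
  define r where "r = max 0 ((exp (2 * M) - 1) / (exp (2 * M) + 1))"
  have "(exp (2 * M) - 1) / (exp (2 * M) + 1) < 1"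
    by (simp add: divide_less_eq add_pos_pos)
  then have r: "0 \<le> r" "r < 1" by (auto simp: r_def)
  have step: "norm (disc_shift (\<gamma> t) (\<gamma> (t + 1))) \<le> r" if "t \<ge> T" for t
    using hyperbolic_dist_le_imp[OF \<gamma>(1) \<gamma>(1), of t "t + 1" M] T0[of t] that
    by (auto simp: T_def r_def)
  have "T \<ge> 0" by (simp add: T_def)
  obtain C S where C: "S \<ge> 0" "\<And>t. t \<ge> S \<Longrightarrow> norm (generator (\<gamma> t)) \<le> C"
  proof (rule generator_bound_backward_orbit[where \<gamma> = \<gamma> and T = T, OF \<gamma>(1) descend step \<open>T \<ge> 0\<close> r])
    fix S C
    assume "0 \<le> S" "\<And>t. t \<ge> S \<Longrightarrow> norm (generator (\<gamma> t)) \<le> C"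
    then show thesis by (rule that)
  qed
  \<comment> \<open>The part of the backward orbit before time S is a compact piece of the forward
    orbit of gamma(S).\<close>
  have "bounded ((\<lambda>s. generator (\<phi> s (\<gamma> S))) ` {0..S})"
  proof (intro compact_imp_bounded compact_continuous_image compact_Icc)
    show "continuous_on {0..S} (\<lambda>s. generator (\<phi> s (\<gamma> S)))"
    proof (rule continuous_on_compose2[OF holomorphic_on_imp_continuous_on[OF holomorphic_generator]])
      show "continuous_on {0..S} (\<lambda>s. \<phi> s (\<gamma> S))"
        by (rule continuous_on_subset[OF continuous_orbit[OF \<gamma>(1)[OF C(1)]]]) auto
    qed (use in_disc[OF _ \<gamma>(1)[OF C(1)]] in auto)
  qed
  then obtain C' where C': "\<forall>v\<in>(\<lambda>s. generator (\<phi> s (\<gamma> S))) ` {0..S}. norm v \<le> C'"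
    unfolding bounded_iff by blast
  \<comment> \<open>The 1 guarantees a positive Lipschitz constant.\<close>
  define D where "D = max 1 (max C C')"
  have "norm (generator (\<gamma> t)) \<le> D" if t: "t \<ge> 0" for t
  proof (cases "t \<ge> S")
    case True
    then show ?thesis using C(2)[of t] by (simp add: D_def)
  next
    case False
    then have "generator (\<gamma> t) = generator (\<phi> (S - t) (\<gamma> S))"
      using descend[of "S - t" t] t by simp
    then have "norm (generator (\<gamma> t)) \<le> C'" using C' t False by auto
    then show ?thesis by (simp add: D_def)
  qed
  then have "D-lipschitz_on {0..} \<gamma>"
    by (intro lipschitz_of_generator_bound \<gamma>(1) descend) (auto simp: D_def)
  moreover have "D > 0" by (simp add: D_def)
  ultimately show ?thesis unfolding dom \<gamma>_def by blast
qed

end
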